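(* For every $d\in\mathbb{N}$ with $1<d<\infty$: $\mathsf{ERM}\equiv_{\mathrm{sW}}\mathsf{PPAC}\equiv_{\mathrm{sW}}\mathsf{PPAC}_{<d}\equiv_{\mathrm{sW}}\mathrm{id}$, and these problems are computable.
   Context: Weihrauch reducibility: a represented space is a set $X$ with a surjective partial $\delta_X:\subseteq\mathbb{N}^\mathbb{N}\to X$; a problem is a partial multivalued map $f:\subseteq X\rightrightarrows Y$; $F$ realizes $f$ if $\delta_YF(p)\in f(\delta_X(p))$ for all $p\in\mathrm{dom}(f\circ\delta_X)$; $f$ is computable if it has a computable realizer. $f\le_{\mathrm{sW}}g$ if there are computable $H,K$ with $HGK$ realizing $f$ whenever $G$ realizes $g$; $\equiv_{\mathrm{sW}}$ the induced equivalence. $\mathrm{id}:\mathbb{N}^\mathbb{N}\to\mathbb{N}^\mathbb{N}$ is the identity on Baire space. Products represented via pairing; $\mathbb{N}$ by $p\mapsto p(0)$. Closed sets: fix a computable bijective enumeration $n\mapsto w_n$ of $\{0,1\}^*$, $B_n=w_n2^\mathbb{N}$. $\mathcal{A}$: closed subsets of $2^\mathbb{N}$, where $\langle p,q\rangle$ names $A$ iff $\{n:n+1\in\mathrm{range}(p)\}=\{n:B_n\cap A\ne\emptyset\}$ and $A=2^\mathbb{N}\setminus\bigcup_{n+1\in\mathrm{range}(q)}B_n$. VC dimension: a finite $A\subseteq\mathbb{N}$ is shattered by $\mathcal{C}\subseteq2^\mathbb{N}$ (elements viewed as subsets of $\mathbb{N}$) if $|\{B\cap A:B\in\mathcal{C}\}|=2^{|A|}$;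 $\mathrm{VCdim}(\mathcal{C})$ is the supremum of sizes of shattered finite sets. PAC learning: samples $\mathcal{S}=(\mathbb{N}\times\{0,1\})^*$; learners $A:\mathcal{S}\to2^\mathbb{N}$; $\mathcal{L}$ the set of learners, represented as Cantor space via a standard coding of $\mathbb{N}\times\mathcal{S}$. A distribution is $\mathcal{D}:\mathbb{N}\times\{0,1\}\to[0,\infty)$ summing to 1; $L_\mathcal{D}(h)=\sum_{h(x)\ne y}\mathcal{D}(x,y)$; $\langle i,j\rangle=\frac12(i+j)(i+j+1)+j$. For nonempty $\mathcal{C}$, $A:\mathcal{S}\to\mathcal{C}$ properly PAC learns $\mathcal{C}$ with $m:\mathbb{N}\to\mathbb{N}$ if for all $i,j$, $n\ge m\langle i,j\rangle$ and all $\mathcal{D}$: $\mathbb{P}_{S\sim\mathcal{D}^n}[L_\mathcal{D}(A(S))\le\inf_{h\in\mathcal{C}}L_\mathcal{D}(h)+2^{-i}]>1-2^{-j}$ ($S$ i.i.d. of length $n$). For $S=((x_1,y_1),\dots,(x_n,y_n))$, $L_S(h)=|\{k:h(x_k)\ne y_k\}|/n$; $A$ is an empirical risk minimizer for $\mathcal{C}$ if $A(S)\in\mathcal{C}$ and $L_S(A(S))=\min_{h\in\mathcal{C}}L_S(h)$ for all $S$. $\mathsf{ERM}:\mathcal{A}\setminus\{\emptyset\}\rightrightarrows\mathcal{L}$, $\mathcal{C}\mapsto\{A:A$ empirical risk minimizer for $\mathcal{C}\}$. $\mathsf{PPAC}:\subseteq\mathcal{A}\times\mathbb{N}\rightrightarrows\mathcal{L}\times\mathbb{N}^\mathbb{N}$,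 $(\mathcal{C},d)\mapsto\{(A,m):A$ properly PAC learns $\mathcal{C}$ with $m\}$, domain $\{(\mathcal{C},d):\mathrm{VCdim}(\mathcal{C})\le d,\ \mathcal{C}\ne\emptyset\}$. $\mathsf{PPAC}_{<d}:\subseteq\mathcal{A}\rightrightarrows\mathcal{L}\times\mathbb{N}^\mathbb{N}$ is the same without input $d$, domain $\{\mathcal{C}:\mathrm{VCdim}(\mathcal{C})<d,\ \mathcal{C}\ne\emptyset\}$. *)

theory Defs
  imports
    "HOL-Analysis.Analysis"
    "HOL-Probability.Probability"
    "HOL-Library.Nat_Bijection"
    "HOL-Library.Extended_Nat"
begin

section \<open>Computable partial functions on Baire space\<close>

text \<open>
  Oracle programs for the functions that are partial recursive relative to a given
  \<open>p :: nat \<Rightarrow> nat\<close>, uniformly in \<open>p\<close>. Programs are unary; several arguments are passed through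
  the pairing \<^const>\<open>prod_encode\<close>. \<open>PrimRec f g\<close> is primitive recursion with parameter and
  \<open>Search f\<close> is unbounded minimization; \<open>Query\<close> asks the oracle. Divergence is \<^const>\<open>None\<close>.
\<close>

datatype prog =
    Zero | Succ | Ident | First | Second | Query
  | Pairing prog prog
  | Compose prog prog
  | PrimRec prog prog
  | Search prog

primrec run :: "prog \<Rightarrow> (nat \<Rightarrow> nat) \<Rightarrow> nat \<Rightarrow> nat option" where
  "run Zero p x = Some 0"
| "run Succ p x = Some (Suc x)"
| "run Ident p x = Some x"
| "run First p x = Some (fst (prod_decode x))"
| "run Second p x = Some (snd (prod_decode x))"
| "run Query p x = Some (p x)"
| "run (Pairing f g) p x =
     Option.bind (run f p x) (\<lambda>a. Option.bind (run g p x) (\<lambda>b. Some (prod_encode (a, b))))"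
| "run (Compose f g) p x = Option.bind (run g p x) (run f p)"
| "run (PrimRec f g) p x =
     (case prod_decode x of (a, n) \<Rightarrow>
        rec_nat (run f p a)
          (\<lambda>k r. Option.bind r (\<lambda>b. run g p (prod_encode (a, prod_encode (k, b))))) n)"
| "run (Search f) p x =
     (if \<exists>k. run f p (prod_encode (x, k)) = Some 0 \<and>
             (\<forall>i<k. \<exists>y. run f p (prod_encode (x, i)) = Some (Suc y))
      then Some (LEAST k. run f p (prod_encode (x, k)) = Some 0)
      else None)"

type_synonym baire = "nat \<Rightarrow> nat"

text \<open>A program may do anything on oracles outside of the domain of \<open>F\<close>.\<close>

definition computable :: "(baire \<rightharpoonup> baire) \<Rightarrow> bool" where
  "computable F \<longleftrightarrow> (\<exists>e. \<forall>p q. F p = Some q \<longrightarrow> (\<forall>n. run e p n = Some (q n)))"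

section \<open>Represented spaces, problems and strong Weihrauch reducibility\<close>

text \<open>
  A representation is a partial map, surjective onto the space it represents; that space is
  therefore recovered as its range \<^const>\<open>ran\<close>.
\<close>

type_synonym 'a representation = "baire \<rightharpoonup> 'a"

text \<open>
  A problem is a partial multivalued map between two represented spaces. Its domain is explicit:
  \<open>solutions f x = None\<close> means that \<open>x\<close> is no instance of \<open>f\<close>, whereas an instance with an
  empty set of solutions would preclude the existence of a realizer.
\<close>

record ('a, 'b) problem =
  in_rep :: "'a representation"
  out_rep :: "'b representation"
  solutions :: "'a \<rightharpoonup> 'b set"

definition realizes :: "(baire \<rightharpoonup> baire) \<Rightarrow> ('a, 'b) problem \<Rightarrow> bool" where
  "realizes F f \<longleftrightarrow>
     (\<forall>p x V. in_rep f p = Some x \<and> solutions f x = Some V \<longrightarrow>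
        (\<exists>q y. F p = Some q \<and> out_rep f q = Some y \<and> y \<in> V))"

definition computable_problem :: "('a, 'b) problem \<Rightarrow> bool" where
  "computable_problem f \<longleftrightarrow> (\<exists>F. computable F \<and> realizes F f)"

definition sW_le :: "('a, 'b) problem \<Rightarrow> ('c, 'd) problem \<Rightarrow> bool" (infix "\<le>\<^sub>s\<^sub>W" 50) where
  "f \<le>\<^sub>s\<^sub>W g \<longleftrightarrow>
     (\<exists>H K. computable H \<and> computable K \<and>
        (\<forall>G. realizes G g \<longrightarrow> realizes (H \<circ>\<^sub>m (G \<circ>\<^sub>m K)) f))"

definition sW_eq :: "('a, 'b) problem \<Rightarrow> ('c, 'd) problem \<Rightarrow> bool" (infix "\<equiv>\<^sub>s\<^sub>W" 50) where
  "f \<equiv>\<^sub>s\<^sub>W g \<longleftrightarrow> f \<le>\<^sub>s\<^sub>W g \<and> g \<le>\<^sub>s\<^sub>W f"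

text \<open>The pairing on Baire space interleaves; these are its two projections.\<close>

definition evens :: "baire \<Rightarrow> baire" where
  "evens r = (\<lambda>n. r (2 * n))"

definition odds :: "baire \<Rightarrow> baire" where
  "odds r = (\<lambda>n. r (2 * n + 1))"

definition rep_prod :: "'a representation \<Rightarrow> 'b representation \<Rightarrow> ('a \<times> 'b) representation" where
  "rep_prod \<delta> \<epsilon> r =
     Option.bind (\<delta> (evens r)) (\<lambda>x. Option.bind (\<epsilon> (odds r)) (\<lambda>y. Some (x, y)))"

definition rep_baire :: "baire representation" where
  "rep_baire p = Some p"

definition rep_nat :: "nat representation" where
  "rep_nat p = Some (p 0)"

definition id_problem :: "(baire, baire) problem" where
  "id_problem =
     \<lparr> in_rep = rep_baire, out_rep = rep_baire, solutions = (\<lambda>p. Some {p}) \<rparr>"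

section \<open>Closed subsets of Cantor space\<close>

type_synonym cantor = "nat \<Rightarrow> bool"

text \<open>The enumeration of binary words is bijective base-2 numeration.\<close>

fun word :: "nat \<Rightarrow> bool list" where
  "word n = (if n = 0 then [] else even n # word ((n - 1) div 2))"

declare word.simps [simp del]

definition cylinder :: "bool list \<Rightarrow> cantor set" where
  "cylinder w = {x. \<forall>i<length w. x i = w ! i}"

definition rep_closed :: "cantor set representation" where
  "rep_closed r =
     (let A = UNIV - (\<Union>n\<in>{n. n + 1 \<in> range (odds r)}. cylinder (word n))
      in if {n. n + 1 \<in> range (evens r)} = {n. cylinder (word n) \<inter> A \<noteq> {}}
         then Some A else None)"

fun word_index :: "bool list \<Rightarrow> nat" where
  "word_index [] = 0"
| "word_index (b # w) = 2 * word_index w + (if b then 2 else 1)"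

lemma word_word_index: "word (word_index w) = w"
proof (induction w)
  case Nil
  then show ?case by (simp add: word.simps)
next
  case (Cons b w)
  have "word (2 * k + 1) = False # word k" "word (2 * k + 2) = True # word k" for k
    by (subst word.simps, simp)+
  with Cons show ?case by (cases b) simp_all
qed

lemma word_index_word: "word_index (word n) = n"
proof (induction n rule: word.induct)
  case (1 n)
  show ?case
  proof (cases "n = 0")
    case True
    then show ?thesis by (simp add: word.simps)
  next
    case False
    then have "word n = even n # word ((n - 1) div 2)"
      by (subst word.simps) simp
    moreover have "word_index (word ((n - 1) div 2)) = (n - 1) div 2"
      using 1 False by blast
    ultimately show ?thesis
      using False by (auto elim!: evenE oddE)
  qed
qed

lemma bij_word: "bij word"
  by (rule o_bij[of word_index]) (auto simp: fun_eq_iff word_word_index word_index_word)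

lemma open_cylinder: "open (cylinder w)"
proof -
  have "open {x :: cantor. x i = b}" for i b
  proof -
    have "open ((\<lambda>x :: cantor. x i) -` {b})"
      by (intro open_vimage continuous_on_product_coordinates) (rule discrete_topology_class.open_discrete)
    then show ?thesis by (simp add: vimage_def)
  qed
  moreover have "cylinder w = (\<Inter>i\<in>{..<length w}. {x. x i = w ! i})"
    by (auto simp: cylinder_def)
  ultimately show ?thesis by (auto intro!: open_INT)
qed

lemma cylinder_basis:
  assumes "open U" "x \<in> U"
  shows "\<exists>w. x \<in> cylinder w \<and> cylinder w \<subseteq> U"
proof -
  have "openin (product_topology (\<lambda>_. euclidean) UNIV) U"
    using assms(1) by (simp add: open_fun_def)
  from product_topology_open_contains_basis[OF this assms(2)]
  obtain X where X: "x \<in> Pi\<^sub>E UNIV X" "finite {i. X i \<noteq> topspace euclidean}"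
      "Pi\<^sub>E UNIV X \<subseteq> U"
    by blast
  obtain N where N: "\<forall>i\<in>{i. X i \<noteq> UNIV}. i < N"
    using X(2) finite_nat_set_iff_bounded by fastforce
  have "cylinder (map x [0..<N]) \<subseteq> Pi\<^sub>E UNIV X"
  proof
    fix y assume y: "y \<in> cylinder (map x [0..<N])"
    show "y \<in> Pi\<^sub>E UNIV X"
    proof (clarsimp simp: PiE_iff)
      fix i
      show "y i \<in> X i"
        using y X(1) N by (cases "X i = UNIV") (auto simp: cylinder_def PiE_iff)
    qed
  qed
  moreover have "x \<in> cylinder (map x [0..<N])"
    by (simp add: cylinder_def)
  ultimately show ?thesis using X(3) by blast
qed

lemma ran_rep_closed: "ran rep_closed = {A. closed A}"
proof (intro equalityI subsetI)
  fix A assume "A \<in> ran rep_closed"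
  then obtain r where "rep_closed r = Some A" by (auto simp: ran_def)
  then have "A = UNIV - (\<Union>n\<in>{n. n + 1 \<in> range (odds r)}. cylinder (word n))"
    by (auto simp: rep_closed_def Let_def split: if_splits)
  then have "- A = (\<Union>n\<in>{n. n + 1 \<in> range (odds r)}. cylinder (word n))" by blast
  then have "open (- A)" using open_cylinder by (metis (no_types, lifting) open_UN)
  then show "A \<in> {A. closed A}" by (simp add: closed_def)
next
  fix A :: "cantor set" assume "A \<in> {A. closed A}"
  then have op: "open (- A)" by (simp add: closed_def)
  define r where "r = (\<lambda>k. if even k = (cylinder (word (k div 2)) \<inter> A \<noteq> {}) then k div 2 + 1 else 0)"
  have e: "evens r = (\<lambda>n. if cylinder (word n) \<inter> A \<noteq> {} then n + 1 else 0)"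
    by (auto simp: evens_def r_def fun_eq_iff)
  have o: "odds r = (\<lambda>n. if cylinder (word n) \<inter> A = {} then n + 1 else 0)"
    by (auto simp: odds_def r_def fun_eq_iff)
  have e': "{n. n + 1 \<in> range (evens r)} = {n. cylinder (word n) \<inter> A \<noteq> {}}"
    unfolding e by (auto simp: image_iff split: if_splits)
  have o': "{n. n + 1 \<in> range (odds r)} = {n. cylinder (word n) \<inter> A = {}}"
    unfolding o by (auto simp: image_iff split: if_splits)
  have "\<exists>n. cylinder (word n) \<inter> A = {} \<and> x \<in> cylinder (word n)" if x: "x \<notin> A" for x
  proof -
    obtain w where "x \<in> cylinder w" "cylinder w \<subseteq> - A"
      using cylinder_basis[OF op, of x] x by auto
    then show ?thesis by (intro exI[of _ "word_index w"]) (auto simp: word_word_index)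
  qed
  then have A: "UNIV - (\<Union>n\<in>{n. n + 1 \<in> range (odds r)}. cylinder (word n)) = A"
    unfolding o' by blast
  have "rep_closed r = Some A"
    unfolding rep_closed_def Let_def A e' by simp
  then show "A \<in> ran rep_closed" by (auto simp: ran_def)
qed

section \<open>VC dimension\<close>

definition shatters :: "cantor set \<Rightarrow> nat set \<Rightarrow> bool" where
  "shatters C A \<longleftrightarrow> card ((\<lambda>B. {n. B n} \<inter> A) ` C) = 2 ^ card A"

definition VCdim :: "cantor set \<Rightarrow> enat" where
  "VCdim C = (SUP A\<in>{A. finite A \<and> shatters C A}. enat (card A))"

section \<open>Learners\<close>

type_synonym sample = "(nat \<times> bool) list"
type_synonym learner = "sample \<Rightarrow> cantor"

definition query_code :: "nat \<times> sample \<Rightarrow> nat" where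
  "query_code = (\<lambda>(x, S). prod_encode (x, list_encode (map (\<lambda>(z, b). 2 * z + of_bool b) S)))"

definition rep_learner :: "learner representation" where
  "rep_learner p =
     (if range p \<subseteq> {0, 1} then Some (\<lambda>S x. p (query_code (x, S)) = 1) else None)"

lemma bij_query_code: "bij query_code"
proof -
  let ?c = "\<lambda>(z :: nat, b :: bool). 2 * z + of_bool b"
  have "bij ?c"
  proof (rule o_bij[of "\<lambda>n. (n div 2, odd n)"])
    show "(\<lambda>n. (n div 2, odd n)) \<circ> ?c = id"
      by (auto simp: fun_eq_iff)
    show "?c \<circ> (\<lambda>n. (n div 2, odd n)) = id"
      by (auto simp: fun_eq_iff elim!: oddE)
  qed
  then have "bij (map ?c)"
    by (intro o_bij[of "map (inv ?c)"])
       (simp_all add: fun_eq_iff bij_is_inj bij_is_surj surj_iff[THEN iffD1] map_idI surj_f_inv_f)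
  then have "bij (list_encode \<circ> map ?c)"
    using bij_comp bij_list_encode by blast
  then have "bij (map_prod id (list_encode \<circ> map ?c))"
    by (simp add: bij_def prod.inj_map map_prod_surj)
  then have "bij (prod_encode \<circ> map_prod id (list_encode \<circ> map ?c))"
    using bij_comp bij_prod_encode by blast
  moreover have "prod_encode \<circ> map_prod id (list_encode \<circ> map ?c) = query_code"
    by (auto simp: query_code_def fun_eq_iff)
  ultimately show ?thesis by simp
qed

definition cantor_pair :: "nat \<Rightarrow> nat \<Rightarrow> nat" where
  "cantor_pair i j = (i + j) * (i + j + 1) div 2 + j"

definition risk :: "(nat \<times> bool) pmf \<Rightarrow> cantor \<Rightarrow> real" where
  "risk D h = (\<Sum>\<^sub>\<infinity>(x, y)\<in>{(x, y). h x \<noteq> y}. pmf D (x, y))"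

definition properly_PAC_learns :: "learner \<Rightarrow> cantor set \<Rightarrow> (nat \<Rightarrow> nat) \<Rightarrow> bool" where
  "properly_PAC_learns A C m \<longleftrightarrow>
     range A \<subseteq> C \<and>
     (\<forall>i j n D. n \<ge> m (cantor_pair i j) \<longrightarrow>
        measure_pmf.prob (replicate_pmf n D)
          {S. risk D (A S) \<le> (INF h\<in>C. risk D h) + 1 / 2 ^ i} > 1 - 1 / 2 ^ j)"

text \<open>On the empty sample, division by zero makes every empirical risk \<open>0\<close>.\<close>

definition empirical_risk :: "sample \<Rightarrow> cantor \<Rightarrow> real" where
  "empirical_risk S h =
     real (card {k. k < length S \<and> h (fst (S ! k)) \<noteq> snd (S ! k)}) / real (length S)"

text \<open>The minimum is over a finite set, since the empirical risk takes finitely many values.\<close>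

definition empirical_risk_minimizer :: "learner \<Rightarrow> cantor set \<Rightarrow> bool" where
  "empirical_risk_minimizer A C \<longleftrightarrow>
     (\<forall>S. A S \<in> C \<and> empirical_risk S (A S) = Min (empirical_risk S ` C))"

lemma finite_empirical_risk: "finite (empirical_risk S ` C)"
proof (rule finite_subset)
  show "empirical_risk S ` C \<subseteq> (\<lambda>k. real k / real (length S)) ` {..length S}"
  proof
    fix y assume "y \<in> empirical_risk S ` C"
    then obtain h where h: "y = empirical_risk S h" by blast
    have "card {k. k < length S \<and> h (fst (S ! k)) \<noteq> snd (S ! k)} \<le> card {..<length S}"
      by (rule card_mono) auto
    then show "y \<in> (\<lambda>k. real k / real (length S)) ` {..length S}"
      unfolding h empirical_risk_def by (intro imageI) simp
  qed
qed simp

section \<open>The learning problems\<close>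

definition ERM :: "(cantor set, learner) problem" where
  "ERM =
     \<lparr> in_rep = rep_closed, out_rep = rep_learner,
       solutions = (\<lambda>C. if closed C \<and> C \<noteq> {}
                        then Some {A. empirical_risk_minimizer A C} else None) \<rparr>"

definition PPAC :: "(cantor set \<times> nat, learner \<times> (nat \<Rightarrow> nat)) problem" where
  "PPAC =
     \<lparr> in_rep = rep_prod rep_closed rep_nat, out_rep = rep_prod rep_learner rep_baire,
       solutions = (\<lambda>(C, d). if closed C \<and> VCdim C \<le> enat d \<and> C \<noteq> {}
                             then Some {(A, m). properly_PAC_learns A C m} else None) \<rparr>"

definition PPAC_less :: "nat \<Rightarrow> (cantor set, learner \<times> (nat \<Rightarrow> nat)) problem" where
  "PPAC_less d =
     \<lparr> in_rep = rep_closed, out_rep = rep_prod rep_learner rep_baire,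
       solutions = (\<lambda>C. if closed C \<and> VCdim C < enat d \<and> C \<noteq> {}
                        then Some {(A, m). properly_PAC_learns A C m} else None) \<rparr>"

end

theory Submission
  imports Defs
begin

text \<open>
  From positive and negative information about a closed class \<open>C\<close> one can decide, by compactness of
  Cantor space, which cylinders meet \<open>C\<close>. Hence a word of minimal empirical risk among those meeting
  \<open>C\<close> can be found, and it extends computably to a member of \<open>C\<close>: this solves \<open>ERM\<close>. By uniform
  convergence an empirical risk minimizer learns every class of VC dimension at most \<open>d\<close>, with a
  sample size that is an explicit elementary function of \<open>d\<close>; this solves \<open>PPAC\<close>. Conversely
  \<open>p\<close> can be read off any proper learner of the singleton class consisting of the graph of \<open>p\<close>.

  For uniform convergence, draw a second sample and swap the two samples at random coordinatewise.
  By Sauer-Shelah only polynomially many loss patterns occur on the double sample, and each has a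
  subgaussian discrepancy. Bounding \<open>\<bar>x\<bar>\<close> by \<open>t + exp (- l * t) / l * (exp (l * x) + exp (- l * x))\<close>
  and summing over all patterns gives a bound on the deviation that is uniform in the hypothesis,
  so that Markov's inequality applies to it directly.
\<close>

section \<open>Computable functionals\<close>

text \<open>The number argument is kept explicit, so that closure rules can follow the syntax of a
  term. The set \<open>P\<close> carries a promise on the oracle under which every evaluation
  terminates.\<close>

definition computable_on :: "baire set \<Rightarrow> (baire \<Rightarrow> nat \<Rightarrow> nat) \<Rightarrow> bool" where
  "computable_on P F \<longleftrightarrow> (\<exists>e. \<forall>p\<in>P. \<forall>x. run e p x = Some (F p x))"

definition decidable_on :: "baire set \<Rightarrow> (baire \<Rightarrow> nat \<Rightarrow> bool) \<Rightarrow> bool" where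
  "decidable_on P Q \<longleftrightarrow> computable_on P (\<lambda>p x. of_bool (Q p x))"

abbreviation pfst :: "nat \<Rightarrow> nat" where "pfst x \<equiv> fst (prod_decode x)"
abbreviation psnd :: "nat \<Rightarrow> nat" where "psnd x \<equiv> snd (prod_decode x)"

lemma computable_onI: "(\<And>p x. p \<in> P \<Longrightarrow> run e p x = Some (F p x)) \<Longrightarrow> computable_on P F"
  unfolding computable_on_def by blast

lemma computable_on_cong:
  "computable_on P F \<Longrightarrow> (\<And>p x. p \<in> P \<Longrightarrow> F p x = G p x) \<Longrightarrow> computable_on P G"
  unfolding computable_on_def by metis

named_theorems computable_intros

lemma computable_var [computable_intros]: "computable_on P (\<lambda>p x. x)"
  by (rule computable_onI[of _ Ident]) simp

lemma computable_Suc [computable_intros]: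
  assumes "computable_on P f"
  shows "computable_on P (\<lambda>p x. Suc (f p x))"
proof -
  obtain e where "\<forall>p\<in>P. \<forall>x. run e p x = Some (f p x)"
    using assms unfolding computable_on_def by blast
  then show ?thesis by (intro computable_onI[of _ "Compose Succ e"]) simp
qed

lemma computable_const [computable_intros]: "computable_on P (\<lambda>p x. c)"
proof (induction c)
  case 0
  show ?case by (rule computable_onI[of _ Zero]) simp
qed (rule computable_Suc)

lemma computable_comp:
  assumes "computable_on P f" "computable_on P g"
  shows "computable_on P (\<lambda>p x. f p (g p x))"
proof -
  obtain e e' where "\<forall>p\<in>P. \<forall>x. run e p x = Some (f p x)" "\<forall>p\<in>P. \<forall>x. run e' p x = Some (g p x)"
    using assms unfolding computable_on_def by blast
  then show ?thesis by (intro computable_onI[of _ "Compose e e'"]) simp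
qed

lemma computable_query [computable_intros]:
  assumes "computable_on P f"
  shows "computable_on P (\<lambda>p x. p (f p x))"
  by (rule computable_comp[OF _ assms]) (rule computable_onI[of _ Query], simp)

lemma computable_pfst [computable_intros]:
  assumes "computable_on P f"
  shows "computable_on P (\<lambda>p x. pfst (f p x))"
  by (rule computable_comp[OF _ assms]) (rule computable_onI[of _ First], simp)

lemma computable_psnd [computable_intros]:
  assumes "computable_on P f"
  shows "computable_on P (\<lambda>p x. psnd (f p x))"
  by (rule computable_comp[OF _ assms]) (rule computable_onI[of _ Second], simp)

lemma computable_pair [computable_intros]:
  assumes "computable_on P f" "computable_on P g"
  shows "computable_on P (\<lambda>p x. prod_encode (f p x, g p x))"
proof -
  obtain e e' where "\<forall>p\<in>P. \<forall>x. run e p x = Some (f p x)" "\<forall>p\<in>P. \<forall>x. run e' p x = Some (g p x)"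
    using assms unfolding computable_on_def by blast
  then show ?thesis by (intro computable_onI[of _ "Pairing e e'"]) simp
qed

text \<open>Programs are unary, so a function of two arguments is first treated on the components of
  a pair; this rule substitutes the actual arguments afterwards.\<close>

lemma computable_comp2:
  assumes "computable_on P (\<lambda>p x. f p (pfst x) (psnd x))"
    and "computable_on P g" "computable_on P h"
  shows "computable_on P (\<lambda>p x. f p (g p x) (h p x))"
  using computable_comp[OF assms(1) computable_pair[OF assms(2,3)]] by simp

text \<open>The parameter of \<open>PrimRec\<close> is the whole input \<open>x\<close>, so that the
  recursion step may depend on it; the number of iterations is substituted last.\<close>

lemma computable_rec_nat [computable_intros]:
  assumes f: "computable_on P f" and b: "computable_on P b"
    and g: "computable_on P (\<lambda>p x. g p (pfst x) (pfst (psnd x)) (psnd (psnd x)))"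
  shows "computable_on P (\<lambda>p x. rec_nat (f p x) (\<lambda>k r. g p x k r) (b p x))"
proof -
  obtain e where e: "\<forall>p\<in>P. \<forall>x. run e p x = Some (f p x)"
    using f unfolding computable_on_def by blast
  obtain e' where e': "\<forall>p\<in>P. \<forall>x. run e' p x = Some (g p (pfst x) (pfst (psnd x)) (psnd (psnd x)))"
    using g unfolding computable_on_def by blast
  have "computable_on P (\<lambda>p x. rec_nat (f p (pfst x)) (\<lambda>k r. g p (pfst x) k r) (psnd x))"
  proof (rule computable_onI[of _ "PrimRec e e'"])
    fix p x assume p: "p \<in> P"
    have "rec_nat (run e p a) (\<lambda>k r. Option.bind r (\<lambda>b. run e' p (prod_encode (a, prod_encode (k, b))))) n
      = Some (rec_nat (f p a) (\<lambda>k r. g p a k r) n)" for a n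
      using p e e' by (induction n) auto
    then show "run (PrimRec e e') p x = Some (rec_nat (f p (pfst x)) (\<lambda>k r. g p (pfst x) k r) (psnd x))"
      by (simp add: case_prod_beta)
  qed
  from computable_comp2[OF this computable_var b] show ?thesis .
qed

lemma computable_on_of_bool [computable_intros]:
  "decidable_on P Q \<Longrightarrow> computable_on P (\<lambda>p x. of_bool (Q p x))"
  by (simp add: decidable_on_def)

section \<open>Arithmetic, decidable predicates and bounded quantifiers\<close>

lemma computable_pred [computable_intros]:
  assumes "computable_on P f"
  shows "computable_on P (\<lambda>p x. f p x - 1)"
proof -
  have "n - 1 = rec_nat 0 (\<lambda>k r. k) n" for n :: nat by (cases n) auto
  then show ?thesis by (simp only:) (intro computable_intros assms)
qed

lemma computable_plus [computable_intros]:
  assumes "computable_on P f" "computable_on P g"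
  shows "computable_on P (\<lambda>p x. f p x + g p x)"
proof -
  have "m + n = rec_nat m (\<lambda>k r. Suc r) n" for m n :: nat by (induction n) auto
  then show ?thesis by (simp only:) (intro computable_intros assms)
qed

lemma computable_times [computable_intros]:
  assumes "computable_on P f" "computable_on P g"
  shows "computable_on P (\<lambda>p x. f p x * g p x)"
proof -
  have *: "m * n = rec_nat 0 (\<lambda>k r. r + m) n" for m n :: nat by (induction n) auto
  \<comment> \<open>The recursion step mentions the factor \<open>m\<close>. With projections in
    place of \<open>f\<close> and \<open>g\<close> the closure rules apply to it directly.\<close>
  have "computable_on P (\<lambda>p x. pfst x * psnd x)"
    unfolding * by (intro computable_intros)
  from computable_comp2[OF this assms] show ?thesis .
qed

lemma computable_power [computable_intros]:
  assumes "computable_on P f" "computable_on P g"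
  shows "computable_on P (\<lambda>p x. f p x ^ g p x)"
proof -
  have *: "m ^ n = rec_nat 1 (\<lambda>k r. r * m) n" for m n :: nat by (induction n) auto
  have "computable_on P (\<lambda>p x. pfst x ^ psnd x)"
    unfolding * by (intro computable_intros)
  from computable_comp2[OF this assms] show ?thesis .
qed

lemma computable_minus [computable_intros]:
  assumes "computable_on P f" "computable_on P g"
  shows "computable_on P (\<lambda>p x. f p x - g p x)"
proof -
  have *: "rec_nat m (\<lambda>k r. r - 1) n = m - n" for m n :: nat by (induction n) auto
  have "computable_on P (\<lambda>p x. rec_nat (f p x) (\<lambda>k r. r - 1) (g p x))"
    by (intro computable_intros assms)
  then show ?thesis by (simp only: *)
qed

lemma decidable_le [computable_intros]:
  assumes "computable_on P f" "computable_on P g"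
  shows "decidable_on P (\<lambda>p x. f p x \<le> g p x)"
proof -
  \<comment> \<open>Subtraction is truncated: \<open>m - n\<close> vanishes exactly if
    \<open>m \<le> n\<close>.\<close>
  have "of_bool (m \<le> n) = 1 - (m - n)" for m n :: nat by auto
  then show ?thesis unfolding decidable_on_def by (simp only:) (intro computable_intros assms)
qed

lemma decidable_conj [computable_intros]:
  assumes "decidable_on P Q" "decidable_on P R"
  shows "decidable_on P (\<lambda>p x. Q p x \<and> R p x)"
  unfolding decidable_on_def of_bool_conj by (intro computable_intros assms)

lemma decidable_not [computable_intros]:
  assumes "decidable_on P Q"
  shows "decidable_on P (\<lambda>p x. \<not> Q p x)"
proof -
  have "of_bool (\<not> b) = 1 - (of_bool b :: nat)" for b by auto
  then show ?thesis unfolding decidable_on_def by (simp only:) (intro computable_intros assms)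
qed

lemma decidable_disj [computable_intros]:
  assumes "decidable_on P Q" "decidable_on P R"
  shows "decidable_on P (\<lambda>p x. Q p x \<or> R p x)"
proof -
  have "a \<or> b \<longleftrightarrow> \<not> (\<not> a \<and> \<not> b)" for a b by blast
  then show ?thesis by (simp only:) (intro computable_intros assms)
qed

lemma decidable_imp [computable_intros]:
  assumes "decidable_on P Q" "decidable_on P R"
  shows "decidable_on P (\<lambda>p x. Q p x \<longrightarrow> R p x)"
  unfolding imp_conv_disj by (intro computable_intros assms)

lemma decidable_iff [computable_intros]:
  assumes "decidable_on P Q" "decidable_on P R"
  shows "decidable_on P (\<lambda>p x. Q p x \<longleftrightarrow> R p x)"
  unfolding iff_conv_conj_imp by (intro computable_intros assms)

lemma decidable_less [computable_intros]:
  assumes "computable_on P f" "computable_on P g"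
  shows "decidable_on P (\<lambda>p x. f p x < g p x)"
  unfolding not_le[symmetric] by (intro computable_intros assms)

lemma decidable_eq [computable_intros]:
  assumes "computable_on P f" "computable_on P g"
  shows "decidable_on P (\<lambda>p x. f p x = g p x)"
  unfolding eq_iff by (intro computable_intros assms)

lemma decidable_comp2:
  assumes "decidable_on P (\<lambda>p x. Q p (pfst x) (psnd x))"
    and "computable_on P g" "computable_on P h"
  shows "decidable_on P (\<lambda>p x. Q p (g p x) (h p x))"
  using assms unfolding decidable_on_def by (rule computable_comp2)

lemma computable_if [computable_intros]:
  assumes "decidable_on P Q" "computable_on P f" "computable_on P g"
  shows "computable_on P (\<lambda>p x. if Q p x then f p x else g p x)"
proof -
  have "(if b then m else n) = of_bool b * m + of_bool (\<not> b) * n" for b and m n :: nat by simp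
  then show ?thesis by (simp only:) (intro computable_intros assms)
qed

lemma computable_card [computable_intros]:
  assumes "computable_on P b" "decidable_on P (\<lambda>p x. Q p (pfst x) (psnd x))"
  shows "computable_on P (\<lambda>p x. card {i. i < b p x \<and> Q p x i})"
proof -
  have "card {i. i < n \<and> R i} = rec_nat 0 (\<lambda>i c. of_bool (R i) + c) n" for R and n :: nat
  proof (induction n)
    case (Suc n)
    have "{i. i < Suc n \<and> R i} = (if R n then insert n {i. i < n \<and> R i} else {i. i < n \<and> R i})"
      by (auto simp: less_Suc_eq)
    then show ?case using Suc by auto
  qed simp
  then show ?thesis
    by (simp only:) (intro computable_intros assms decidable_comp2[OF assms(2)])
qed

lemma decidable_bex [computable_intros]:
  assumes "computable_on P b" "decidable_on P (\<lambda>p x. Q p (pfst x) (psnd x))"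
  shows "decidable_on P (\<lambda>p x. \<exists>i<b p x. Q p x i)"
proof -
  have "(\<exists>i<n. R i) \<longleftrightarrow> 0 < card {i. i < n \<and> R i}" for R and n :: nat
    by (auto simp: card_gt_0_iff)
  then show ?thesis by (simp only:) (intro computable_intros assms)
qed

lemma decidable_ball [computable_intros]:
  assumes "computable_on P b" "decidable_on P (\<lambda>p x. Q p (pfst x) (psnd x))"
  shows "decidable_on P (\<lambda>p x. \<forall>i<b p x. Q p x i)"
proof -
  have "(\<forall>i<n. R i) \<longleftrightarrow> \<not> (\<exists>i<n. \<not> R i)" for R and n :: nat by auto
  then show ?thesis by (simp only:) (intro computable_intros assms)
qed

text \<open>\<open>Search\<close> looks for a zero, so it is run on the indicator of the negation of
  \<open>Q\<close>. The existence of a witness for all oracles in \<open>P\<close> makes it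
  terminate.\<close>

lemma computable_Least:
  assumes "decidable_on P (\<lambda>p x. Q p (pfst x) (psnd x))"
    and ex: "\<And>p x. p \<in> P \<Longrightarrow> \<exists>k. Q p x k"
  shows "computable_on P (\<lambda>p x. LEAST k. Q p x k)"
proof -
  have "computable_on P (\<lambda>p x. of_bool (\<not> Q p (pfst x) (psnd x)))"
    by (intro computable_intros assms(1))
  then obtain e where "\<And>p x. p \<in> P \<Longrightarrow> run e p x = Some (of_bool (\<not> Q p (pfst x) (psnd x)))"
    unfolding computable_on_def by blast
  then have e: "run e p (prod_encode (x, k)) = Some (of_bool (\<not> Q p x k))" if "p \<in> P" for p x k
    using that by simp
  show ?thesis
  proof (rule computable_onI[of _ "Search e"])
    fix p x assume p: "p \<in> P"
    obtain k where "Q p x k" "\<forall>i<k. \<not> Q p x i"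
      using ex[OF p] exists_least_iff[of "Q p x"] by blast
    then have "\<exists>k. run e p (prod_encode (x, k)) = Some 0 \<and>
             (\<forall>i<k. \<exists>y. run e p (prod_encode (x, i)) = Some (Suc y))"
      by (intro exI[of _ k]) (simp add: e[OF p])
    moreover have "run e p (prod_encode (x, k)) = Some 0 \<longleftrightarrow> Q p x k" for k
      by (simp add: e[OF p])
    ultimately show "run (Search e) p x = Some (LEAST k. Q p x k)"
      unfolding run.simps by (simp only: if_True)
  qed
qed

lemma computable_div2 [computable_intros]:
  assumes "computable_on P f"
  shows "computable_on P (\<lambda>p x. f p x div 2)"
proof -
  have *: "(LEAST k. n < 2 * k + 2) = n div 2" for n :: nat
    by (rule Least_equality) auto
  have "\<exists>k. n < 2 * k + 2" for n :: nat
    by (rule exI[of _ n]) simp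
  then have "computable_on P (\<lambda>p x. LEAST k. x < 2 * k + 2)"
    by (intro computable_Least computable_intros)
  then have "computable_on P (\<lambda>p x. x div 2)" by (simp only: *)
  from computable_comp[OF this assms] show ?thesis .
qed

lemma decidable_even [computable_intros]:
  assumes "computable_on P f"
  shows "decidable_on P (\<lambda>p x. even (f p x))"
proof -
  have *: "2 * (n div 2) = n \<longleftrightarrow> even n" for n :: nat by presburger
  have "decidable_on P (\<lambda>p x. 2 * (f p x div 2) = f p x)"
    by (intro computable_intros assms)
  then show ?thesis by (simp only: *)
qed

section \<open>Composition of oracle programs\<close>

primrec subst_query :: "prog \<Rightarrow> prog \<Rightarrow> prog" where
  "subst_query h Zero = Zero"
| "subst_query h Succ = Succ"
| "subst_query h Ident = Ident"
| "subst_query h First = First"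
| "subst_query h Second = Second"
| "subst_query h Query = h"
| "subst_query h (Pairing f g) = Pairing (subst_query h f) (subst_query h g)"
| "subst_query h (Compose f g) = Compose (subst_query h f) (subst_query h g)"
| "subst_query h (PrimRec f g) = PrimRec (subst_query h f) (subst_query h g)"
| "subst_query h (Search f) = Search (subst_query h f)"

text \<open>If \<open>h\<close> computes the oracle \<open>q\<close> from \<open>p\<close>,
  replacing each oracle call by \<open>h\<close> simulates a run on \<open>q\<close>. Equality of
  functions, rather than of values at one input, lets the induction pass through
  \<open>Search\<close> and recursion.\<close>

lemma run_subst_query:
  assumes "\<And>x. run h p x = Some (q x)"
  shows "run (subst_query h e) p = run e q"
  by (induction e) (rule ext, simp add: assms)+

lemma computable_map_comp:
  assumes "computable F" "computable G"
  shows "computable (F \<circ>\<^sub>m G)"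
proof -
  obtain e e' where e: "\<And>p q n. F p = Some q \<Longrightarrow> run e p n = Some (q n)"
    and e': "\<And>p q n. G p = Some q \<Longrightarrow> run e' p n = Some (q n)"
    using assms unfolding computable_def by blast
  have "run (subst_query e' e) p n = Some (q n)" if "(F \<circ>\<^sub>m G) p = Some q" for p q n
  proof -
    from that obtain s where "G p = Some s" "F s = Some q" by (auto simp: map_comp_Some_iff)
    then show ?thesis using e e' run_subst_query[of e' p s e] by simp
  qed
  then show ?thesis unfolding computable_def by blast
qed

lemma computable_on_comp_oracle:
  assumes "computable_on Q G" "computable_on P F" "\<And>p. p \<in> P \<Longrightarrow> F p \<in> Q"
  shows "computable_on P (\<lambda>p. G (F p))"
proof -
  obtain e e' where "\<forall>p\<in>Q. \<forall>x. run e p x = Some (G p x)" "\<forall>p\<in>P. \<forall>x. run e' p x = Some (F p x)"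
    using assms unfolding computable_on_def by blast
  then show ?thesis using assms(3) run_subst_query[of e' _ _ e]
    by (intro computable_onI[of _ "subst_query e' e"]) simp
qed

section \<open>Partial functionals and reductions to the identity\<close>

definition restrict_to :: "baire set \<Rightarrow> (baire \<Rightarrow> baire) \<Rightarrow> baire \<rightharpoonup> baire" where
  "restrict_to P F p = (if p \<in> P then Some (F p) else None)"

lemma computable_restrict_to: "computable_on P F \<Longrightarrow> computable (restrict_to P F)"
  unfolding computable_def computable_on_def restrict_to_def by (auto split: if_splits)

lemma sW_le_trans:
  assumes "f \<le>\<^sub>s\<^sub>W g" "g \<le>\<^sub>s\<^sub>W h"
  shows "f \<le>\<^sub>s\<^sub>W h"
proof -
  obtain H K where 1: "computable H" "computable K"
    "\<And>G. realizes G g \<Longrightarrow> realizes (H \<circ>\<^sub>m (G \<circ>\<^sub>m K)) f"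
    using assms(1) unfolding sW_le_def by blast
  obtain H' K' where 2: "computable H'" "computable K'"
    "\<And>G. realizes G h \<Longrightarrow> realizes (H' \<circ>\<^sub>m (G \<circ>\<^sub>m K')) g"
    using assms(2) unfolding sW_le_def by blast
  have assoc: "(H \<circ>\<^sub>m H') \<circ>\<^sub>m (G \<circ>\<^sub>m (K' \<circ>\<^sub>m K)) = H \<circ>\<^sub>m ((H' \<circ>\<^sub>m (G \<circ>\<^sub>m K')) \<circ>\<^sub>m K)" for G
    by (auto simp: map_comp_def fun_eq_iff split: option.split)
  show ?thesis unfolding sW_le_def
    using 1 2 computable_map_comp
    by (intro exI[of _ "H \<circ>\<^sub>m H'"] exI[of _ "K' \<circ>\<^sub>m K"]) (simp add: assoc)
qed

lemma realizes_Some: "realizes Some id_problem"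
  by (simp add: realizes_def id_problem_def rep_baire_def)

lemma realizes_id_problem:
  assumes "realizes G id_problem"
  shows "G = Some"
proof
  fix p
  show "G p = Some p"
    using assms unfolding realizes_def id_problem_def rep_baire_def by simp
qed

lemma computable_Some: "computable Some"
  unfolding computable_def by (intro exI[of _ Query]) simp

text \<open>The only realizer of \<open>id_problem\<close> is \<open>Some\<close>, so a reduction to
  it composes to a computable realizer, and a computable realizer serves as the outer map of a
  reduction. Upper bounds in the theorem thus become computability proofs.\<close>

lemma computable_problem_iff_le_id: "computable_problem f \<longleftrightarrow> f \<le>\<^sub>s\<^sub>W id_problem"
proof
  assume "computable_problem f"
  then obtain F where F: "computable F" "realizes F f" unfolding computable_problem_def by blast
  have "F \<circ>\<^sub>m (Some \<circ>\<^sub>m Some) = F" by (auto simp: map_comp_def)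
  then show "f \<le>\<^sub>s\<^sub>W id_problem"
    unfolding sW_le_def using F computable_Some realizes_id_problem by metis
next
  assume "f \<le>\<^sub>s\<^sub>W id_problem"
  then show "computable_problem f"
    unfolding sW_le_def computable_problem_def
    using realizes_Some computable_map_comp computable_Some by metis
qed

section \<open>Decidability of the tree of a closed set\<close>

lemma word_index_append: "word_index (u @ v) = word_index u + 2 ^ length u * word_index v"
  by (induction u) (auto simp: algebra_simps)

text \<open>The words of length \<open>k\<close> occupy the indices from \<open>2 ^ k - 1\<close> to
  \<open>2 ^ Suc k - 2\<close>. This makes the length computable by search and turns quantifiers
  over words of a given length into bounded ones.\<close>

lemma word_index_bounds: "2 ^ length w \<le> word_index w + 1 \<and> word_index w + 1 < 2 ^ Suc (length w)"
  by (induction w) auto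

lemma length_word_eq_Least: "length (word n) = (LEAST k. n + 1 < 2 ^ Suc k)"
proof (rule Least_equality[symmetric])
  show "n + 1 < 2 ^ Suc (length (word n))"
    using word_index_bounds[of "word n"] by (simp add: word_index_word)
next
  fix k assume "n + 1 < 2 ^ Suc k"
  moreover have "2 ^ length (word n) \<le> n + 1"
    using word_index_bounds[of "word n"] by (simp add: word_index_word)
  ultimately have "(2::nat) ^ length (word n) < 2 ^ Suc k" by linarith
  then have "length (word n) < Suc k" by (rule power_less_imp_less_exp[rotated]) simp
  then show "length (word n) \<le> k" by simp
qed

lemma less_of_length_word: "length (word n) = k \<Longrightarrow> n < 2 ^ Suc k"
  using word_index_bounds[of "word n"] by (auto simp: word_index_word)

lemma computable_length_word [computable_intros]:
  assumes "computable_on P f"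
  shows "computable_on P (\<lambda>p x. length (word (f p x)))"
proof -
  have "\<exists>k. n + 1 < 2 ^ Suc k" for n :: nat
    using less_exp[of "n + 1"] less_SucI by (intro exI[of _ "n"]) auto
  then have "computable_on P (\<lambda>p x. LEAST k. x + 1 < 2 ^ Suc k)"
    by (intro computable_Least computable_intros)
  then have "computable_on P (\<lambda>p x. length (word x))"
    by (simp only: length_word_eq_Least)
  from computable_comp[OF this assms] show ?thesis .
qed

lemma word_tl: "word ((n - 1) div 2) = tl (word n)"
  by (cases "n = 0") (simp_all add: word.simps[of n] word.simps[of 0])

lemma word_funpow_tl: "word (rec_nat n (\<lambda>_ m. (m - 1) div 2) i) = drop i (word n)"
  by (induction i) (simp_all add: word_tl tl_drop drop_Suc word_tl[simplified])

lemma hd_word: "word n \<noteq> [] \<Longrightarrow> hd (word n) = even n"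
  by (cases "n = 0") (simp_all add: word.simps[of n] word.simps[of 0])

text \<open>The parity of an index is the first letter and \<open>(m - 1) div 2\<close> removes it,
  so bits are obtained by primitive recursion. Past the end of the word the index is
  \<open>0\<close> and the value \<open>True\<close>.\<close>

definition word_bit :: "nat \<Rightarrow> nat \<Rightarrow> bool" where
  "word_bit n i = even (rec_nat n (\<lambda>_ m. (m - 1) div 2) i)"

lemma word_bit: "i < length (word n) \<Longrightarrow> word_bit n i = word n ! i"
  unfolding word_bit_def
  by (subst hd_word[symmetric]) (simp_all only: word_funpow_tl hd_drop_conv_nth drop_eq_Nil not_le)

lemma decidable_word_bit [computable_intros]:
  assumes "computable_on P f" "computable_on P g"
  shows "decidable_on P (\<lambda>p x. word_bit (f p x) (g p x))"
  unfolding word_bit_def by (intro computable_intros assms)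

text \<open>By \<open>word_index_append\<close>, \<open>v\<close> is the index of the remaining
  word. It never exceeds \<open>n\<close>, so a bounded search decides the prefix relation.\<close>

definition word_prefix :: "nat \<Rightarrow> nat \<Rightarrow> bool" where
  "word_prefix m n \<longleftrightarrow> (\<exists>v<n + 1. n = m + 2 ^ length (word m) * v)"

lemma word_prefix_iff: "word_prefix m n \<longleftrightarrow> (\<exists>v. word n = word m @ v)"
proof
  assume "word_prefix m n"
  then obtain v where "n = m + 2 ^ length (word m) * v" unfolding word_prefix_def by blast
  then have "n = word_index (word m @ word v)" by (simp add: word_index_append word_index_word)
  then show "\<exists>v. word n = word m @ v" by (metis word_word_index)
next
  assume "\<exists>v. word n = word m @ v"
  then obtain v where "word n = word m @ v" by blast
  then have "n = m + 2 ^ length (word m) * word_index v"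
    by (metis word_index_append word_index_word)
  moreover from this have "word_index v < n + 1" by (simp add: less_Suc_eq_le trans_le_add2)
  ultimately show "word_prefix m n" unfolding word_prefix_def by blast
qed

lemma decidable_word_prefix [computable_intros]:
  assumes "computable_on P f" "computable_on P g"
  shows "decidable_on P (\<lambda>p x. word_prefix (f p x) (g p x))"
proof -
  have "decidable_on P (\<lambda>p x. word_prefix (pfst x) (psnd x))"
    unfolding word_prefix_def by (intro computable_intros)
  from decidable_comp2[OF this assms] show ?thesis .
qed

section \<open>Cylinders, compactness and the names of closed sets\<close>

lemma cylinder_append: "cylinder (u @ v) \<subseteq> cylinder u"
  by (force simp: cylinder_def nth_append)

lemma cylinder_nonempty: "cylinder w \<noteq> {}"
proof -
  have "(\<lambda>i. w ! i) \<in> cylinder w" by (simp add: cylinder_def)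
  then show ?thesis by blast
qed

lemma mem_cylinder_iff: "x \<in> cylinder w \<longleftrightarrow> w = map x [0..<length w]"
  unfolding list_eq_iff_nth_eq by (auto simp: cylinder_def)

lemma prefix_of_mem_cylinder:
  assumes "x \<in> cylinder u" "x \<in> cylinder v" "length u \<le> length v"
  shows "\<exists>t. v = u @ t"
proof -
  have "u = take (length u) v"
    using assms by (intro nth_equalityI) (auto simp: cylinder_def)
  then show ?thesis by (metis append_take_drop_id)
qed

text \<open>Without \<open>length (word a) \<le> k\<close> the condition would hold vacuously for small \<open>k\<close>.\<close>

definition covered :: "baire \<Rightarrow> nat \<Rightarrow> nat \<Rightarrow> bool" where
  "covered r a k \<longleftrightarrow> length (word a) \<le> k \<and>
     (\<forall>n<2 ^ Suc k. length (word n) = k \<and> word_prefix a n \<longrightarrow>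
       (\<exists>i<k. 0 < r (2 * i + 1) \<and> word_prefix (r (2 * i + 1) - 1) n))"

lemma decidable_covered:
  "decidable_on P (\<lambda>r x. covered r (pfst x) (psnd x))"
  unfolding covered_def by (intro computable_intros)

definition meets :: "cantor set \<Rightarrow> nat \<Rightarrow> bool" where
  "meets C a \<longleftrightarrow> cylinder (word a) \<inter> C \<noteq> {}"

lemma rep_closedD:
  assumes "rep_closed r = Some C"
  shows "meets C a \<longleftrightarrow> (\<exists>k. r (2 * k) = Suc a)"
    and "x \<in> C \<longleftrightarrow> (\<forall>i. 0 < r (2 * i + 1) \<longrightarrow> x \<notin> cylinder (word (r (2 * i + 1) - 1)))"
    and "closed C"
proof -
  have C: "C = UNIV - (\<Union>n\<in>{n. n + 1 \<in> range (odds r)}. cylinder (word n))"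
    and E: "{n. n + 1 \<in> range (evens r)} = {n. cylinder (word n) \<inter> C \<noteq> {}}"
    using assms unfolding rep_closed_def Let_def by (auto split: if_splits)
  from E have "a + 1 \<in> range (evens r) \<longleftrightarrow> cylinder (word a) \<inter> C \<noteq> {}" by blast
  then show "meets C a \<longleftrightarrow> (\<exists>k. r (2 * k) = Suc a)"
    unfolding meets_def evens_def by (auto simp: image_iff) metis+
  have *: "n + 1 \<in> range (odds r) \<longleftrightarrow> (\<exists>i. 0 < r (2 * i + 1) \<and> n = r (2 * i + 1) - 1)" for n
    unfolding odds_def by (auto simp: image_iff) (metis diff_Suc_1 zero_less_Suc Suc_pred)+
  show "x \<in> C \<longleftrightarrow> (\<forall>i. 0 < r (2 * i + 1) \<longrightarrow> x \<notin> cylinder (word (r (2 * i + 1) - 1)))"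
    unfolding C * by blast
  show "closed C" using assms ran_rep_closed by (auto simp: ran_def)
qed

lemma compact_cantor: "compact (UNIV :: cantor set)"
proof -
  have "compact_space (product_topology (\<lambda>i::nat. euclidean :: bool topology) UNIV)"
    by (rule compact_space_product_topology[THEN iffD2]) (simp add: compact_space_def finite_imp_compact)
  then show ?thesis by (simp add: compact_space_def euclidean_product_topology)
qed

text \<open>The words of one length partition Cantor space, so the complement is a union of open
  cylinders.\<close>

lemma closed_cylinder: "closed (cylinder w)"
proof -
  have "x \<notin> cylinder w \<longleftrightarrow> (\<exists>v. length v = length w \<and> v \<noteq> w \<and> x \<in> cylinder v)" for x
    by (metis length_map length_upt diff_zero mem_cylinder_iff)
  then have "- cylinder w = (\<Union>v\<in>{v. length v = length w \<and> v \<noteq> w}. cylinder v)" by blast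
  then have "open (- cylinder w)" using open_cylinder by auto
  then show ?thesis by (simp add: closed_def)
qed

text \<open>By compactness finitely many excluded cylinders cover the cylinder of
  \<open>word a\<close>. Once \<open>k\<close> exceeds their positions in the enumeration and is at
  least their lengths, every extension of \<open>word a\<close> to length \<open>k\<close> extends
  one of their words.\<close>

lemma ex_covered:
  assumes r: "rep_closed r = Some C" and a: "\<not> meets C a"
  shows "\<exists>k. covered r a k"
proof -
  let ?I = "{i. 0 < r (2 * i + 1)}" and ?w = "\<lambda>i. word (r (2 * i + 1) - 1)"
  have "compact (cylinder (word a))"
    using compact_cantor closed_cylinder by (metis compact_Int_closed inf_top_left)
  moreover have "cylinder (word a) \<subseteq> (\<Union>i\<in>?I. cylinder (?w i))"
    using a rep_closedD(2)[OF r] unfolding meets_def by blast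
  ultimately obtain I where I: "I \<subseteq> ?I" "finite I" "cylinder (word a) \<subseteq> (\<Union>i\<in>I. cylinder (?w i))"
    by (rule compactE_image[OF _ open_cylinder]) auto
  \<comment> \<open>The sum dominates each of its terms; \<open>Suc i\<close> makes the bound on
    positions strict.\<close>
  define k where "k = length (word a) + (\<Sum>i\<in>I. Suc i + length (?w i))"
  have k: "i < k \<and> length (?w i) \<le> k" if "i \<in> I" for i
    using member_le_sum[OF that, of "\<lambda>i. Suc i + length (?w i)"] I(2) unfolding k_def by simp
  have "\<exists>i<k. 0 < r (2 * i + 1) \<and> word_prefix (r (2 * i + 1) - 1) n"
    if n: "length (word n) = k" "word_prefix a n" for n
  proof -
    obtain x where x: "x \<in> cylinder (word n)" using cylinder_nonempty by blast
    then have "x \<in> cylinder (word a)"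
      using n(2) cylinder_append unfolding word_prefix_iff by fastforce
    then obtain i where i: "i \<in> I" "x \<in> cylinder (?w i)" using I(3) by blast
    then have "word_prefix (r (2 * i + 1) - 1) n"
      unfolding word_prefix_iff using prefix_of_mem_cylinder[OF i(2) x] k n(1) by simp
    then show ?thesis using i(1) I(1) k by blast
  qed
  then have "covered r a k" unfolding covered_def k_def by simp
  then show ?thesis ..
qed

text \<open>A member of \<open>C\<close> in the cylinder would have a prefix of length
  \<open>k\<close> that extends an excluded word.\<close>

lemma covered_imp_not_meets:
  assumes r: "rep_closed r = Some C" and "covered r a k"
  shows "\<not> meets C a"
proof
  assume "meets C a"
  then obtain x where x: "x \<in> cylinder (word a)" "x \<in> C" unfolding meets_def by blast
  define n where "n = word_index (map x [0..<k])"
  have n: "word n = map x [0..<k]" by (simp add: n_def word_word_index)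
  then have xn: "x \<in> cylinder (word n)" "length (word n) = k" by (simp_all add: cylinder_def)
  moreover have "word_prefix a n"
    unfolding word_prefix_iff using prefix_of_mem_cylinder[OF x(1) xn(1)] assms(2) xn(2)
    unfolding covered_def by simp
  ultimately obtain i where "0 < r (2 * i + 1)" "word_prefix (r (2 * i + 1) - 1) n"
    using assms(2) less_of_length_word unfolding covered_def by blast
  then have "x \<in> cylinder (word (r (2 * i + 1) - 1))"
    using xn(1) cylinder_append unfolding word_prefix_iff by fastforce
  then show False using rep_closedD(2)[OF r] x(2) \<open>0 < r (2 * i + 1)\<close> by blast
qed

text \<open>The tree of prefixes of members of \<open>C\<close>, as a characteristic function, so
  that it can serve as an oracle.\<close>

definition tree_of :: "cantor set \<Rightarrow> baire" where
  "tree_of C a = of_bool (meets C a)"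

definition closed_names :: "baire set" where
  "closed_names = {r. rep_closed r \<noteq> None}"

text \<open>The positive half of a name confirms that a cylinder meets the set, the negative half
  that it does not; searching for either kind of evidence terminates.\<close>

lemma computable_tree_of: "computable_on closed_names (\<lambda>r. tree_of (the (rep_closed r)))"
proof -
  \<comment> \<open>A single \<open>k\<close> serves as position in the positive enumeration and as
    stage of the covering test.\<close>
  define stage where "stage = (\<lambda>r a. LEAST k. r (2 * k) = Suc a \<or> covered r a k)"
  have ex: "\<exists>k. r (2 * k) = Suc a \<or> covered r a k" if "rep_closed r = Some C" for r a C
    using rep_closedD(1)[OF that] ex_covered[OF that] by blast
  have "computable_on closed_names stage"
    unfolding stage_def
    by (intro computable_Least computable_intros decidable_covered)
      (use ex in \<open>auto simp: closed_names_def\<close>)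
  \<comment> \<open>The two alternatives exclude each other, so testing the positive one at the
    stage found gives the answer.\<close>
  then have "computable_on closed_names (\<lambda>r a. of_bool (r (2 * stage r a) = Suc a))"
    by (intro computable_intros)
  then show ?thesis
  proof (rule computable_on_cong)
    fix r a assume "r \<in> closed_names"
    then obtain C where r: "rep_closed r = Some C" by (auto simp: closed_names_def)
    have "r (2 * stage r a) = Suc a \<or> covered r a (stage r a)"
      unfolding stage_def by (rule LeastI_ex[OF ex[OF r]])
    then have "r (2 * stage r a) = Suc a \<longleftrightarrow> meets C a"
      using covered_imp_not_meets[OF r] rep_closedD(1)[OF r] by blast
    then show "of_bool (r (2 * stage r a) = Suc a) = tree_of (the (rep_closed r)) a"
      by (simp add: tree_of_def r)
  qed
qed

section \<open>A computable empirical risk minimizer\<close>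

definition code_drop :: "nat \<Rightarrow> nat \<Rightarrow> nat" where
  "code_drop i s = rec_nat s (\<lambda>_ l. psnd (l - 1)) i"

lemma computable_code_drop [computable_intros]:
  assumes "computable_on P f" "computable_on P g"
  shows "computable_on P (\<lambda>p x. code_drop (f p x) (g p x))"
  unfolding code_drop_def by (intro computable_intros assms)

text \<open>A nonempty list has the successor of a pair as its code, so \<open>psnd (l - 1)\<close>
  removes the head. The code \<open>0\<close> of the empty list is a fixed point, in agreement with
  \<open>tl []\<close>.\<close>

lemma code_drop: "code_drop i (list_encode xs) = list_encode (drop i xs)"
proof (induction i)
  case 0
  show ?case by (simp add: code_drop_def)
next
  case (Suc i)
  have "psnd (list_encode ys - 1) = list_encode (tl ys)" for ys
  proof (cases ys)
    case Nil
    have "prod_decode 0 = (0, 0)"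
      using prod_encode_inverse[of "(0, 0)"] by (simp add: prod_encode_def)
    then show ?thesis using Nil by simp
  qed simp
  then show ?case using Suc by (simp add: code_drop_def tl_drop drop_Suc del: One_nat_def)
qed

lemma length_le_list_encode: "length xs \<le> list_encode xs"
  by (induction xs) (auto intro: order_trans[OF _ le_prod_encode_2])

text \<open>Together with \<open>length_le_list_encode\<close> this lets the code of a sample serve
  both as a loop bound and as a word length.\<close>

lemma nth_less_list_encode: "i < length xs \<Longrightarrow> xs ! i < list_encode xs"
proof (induction xs arbitrary: i)
  case (Cons x xs)
  then show ?case
    using le_prod_encode_1[of x "list_encode xs"] le_prod_encode_2[of "list_encode xs" x]
    by (cases i) (auto simp: less_Suc_eq_le intro: order.strict_implies_order order.strict_trans2)
qed simp

definition sample_code :: "sample \<Rightarrow> nat" where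
  "sample_code S = list_encode (map (\<lambda>(z, b). 2 * z + of_bool b) S)"

lemma query_code_eq: "query_code (x, S) = prod_encode (x, sample_code S)"
  by (simp add: query_code_def sample_code_def)

text \<open>On the code \<open>s\<close> of a sample, \<open>0 < code_drop i s\<close> says that
  entry \<open>i\<close> exists. An entry \<open>2 * z + of_bool b\<close> yields its point by
  halving and its label by parity.\<close>

definition word_errors :: "nat \<Rightarrow> nat \<Rightarrow> nat" where
  "word_errors a s = card {i. i < s \<and> 0 < code_drop i s \<and>
     \<not> (word_bit a (pfst (code_drop i s - 1) div 2) \<longleftrightarrow> \<not> even (pfst (code_drop i s - 1)))}"

lemma computable_word_errors [computable_intros]:
  assumes "computable_on P f" "computable_on P g"
  shows "computable_on P (\<lambda>p x. word_errors (f p x) (g p x))"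
proof -
  have "computable_on P (\<lambda>p x. word_errors (pfst x) (psnd x))"
    unfolding word_errors_def by (intro computable_intros)
  from computable_comp2[OF this assms] show ?thesis .
qed

lemma word_errors_sample_code:
  assumes "h \<in> cylinder (word a)" "length (word a) = sample_code S"
  shows "word_errors a (sample_code S) = card {k. k < length S \<and> h (fst (S ! k)) \<noteq> snd (S ! k)}"
proof -
  let ?xs = "map (\<lambda>(z, b). 2 * z + of_bool b) S :: nat list"
  have "i < sample_code S \<and> 0 < code_drop i (sample_code S) \<longleftrightarrow> i < length S" for i
    using length_le_list_encode[of ?xs] list_encode_eq[of "drop i ?xs" "[]"]
    by (auto simp: sample_code_def code_drop)
  moreover have "(word_bit a (pfst (code_drop i (sample_code S) - 1) div 2) \<longleftrightarrow>
      \<not> even (pfst (code_drop i (sample_code S) - 1))) \<longleftrightarrow> h (fst (S ! i)) = snd (S ! i)"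
    if i: "i < length S" for i
  proof -
    obtain z b where zb: "S ! i = (z, b)" by fastforce
    have "drop i ?xs = ?xs ! i # drop (Suc i) ?xs"
      using i by (intro Cons_nth_drop_Suc[symmetric]) simp
    then have e: "pfst (code_drop i (sample_code S) - 1) = 2 * z + of_bool b"
      using i zb unfolding sample_code_def code_drop by simp
    have "?xs ! i < sample_code S"
      unfolding sample_code_def using i by (intro nth_less_list_encode) simp
    then have "z < length (word a)" using i zb assms(2) by simp
    then show ?thesis using assms(1) zb unfolding e by (auto simp: word_bit cylinder_def)
  qed
  ultimately have "{i. i < sample_code S \<and> 0 < code_drop i (sample_code S) \<and>
     \<not> (word_bit a (pfst (code_drop i (sample_code S) - 1) div 2) \<longleftrightarrow> \<not> even (pfst (code_drop i (sample_code S) - 1)))}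
    = {k. k < length S \<and> h (fst (S ! k)) \<noteq> snd (S ! k)}" by blast
  then show ?thesis unfolding word_errors_def by simp
qed

text \<open>
  The code \<open>s\<close> of a sample exceeds all of its points, so words of length \<open>s\<close> determine its errors.
\<close>

definition optimal_word :: "baire \<Rightarrow> nat \<Rightarrow> nat \<Rightarrow> bool" where
  "optimal_word t s a \<longleftrightarrow> length (word a) = s \<and> t a = 1 \<and>
     (\<forall>n<2 ^ Suc s. length (word n) = s \<and> t n = 1 \<longrightarrow> word_errors a s \<le> word_errors n s)"

definition best_word :: "baire \<Rightarrow> nat \<Rightarrow> nat" where
  "best_word t s = (LEAST a. optimal_word t s a)"

text \<open>By \<open>word_extend\<close> the two summands append \<open>False\<close> and
  \<open>True\<close>. The path prefers \<open>False\<close>, so from a node of the tree it is the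
  leftmost one.\<close>

definition branch :: "baire \<Rightarrow> nat \<Rightarrow> nat \<Rightarrow> nat" where
  "branch t a k = rec_nat a (\<lambda>_ b. if t (b + 2 ^ length (word b)) = 1
     then b + 2 ^ length (word b) else b + 2 * 2 ^ length (word b)) k"

text \<open>A query pairs a point with a sample code. After \<open>Suc (pfst q)\<close> extensions
  the word is long enough to have a bit at position \<open>pfst q\<close>, whatever the length of
  the best word.\<close>

definition learner_of :: "baire \<Rightarrow> baire" where
  "learner_of t q = of_bool (word_bit (branch t (best_word t (psnd q)) (Suc (pfst q))) (pfst q))"

definition trees :: "baire set" where
  "trees = {tree_of C | C. closed C \<and> C \<noteq> {}}"

lemma meets_prefix: "x \<in> C \<Longrightarrow> meets C (word_index (map x [0..<k]))"
  by (auto simp: meets_def word_word_index cylinder_def)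

text \<open>A prefix of a member of \<open>C\<close> is a candidate, and error counts are natural
  numbers, so some candidate has the fewest errors.\<close>

lemma ex_optimal_word:
  assumes "C \<noteq> {}"
  shows "\<exists>a. optimal_word (tree_of C) s a"
proof -
  obtain x where "x \<in> C" using assms by blast
  then have "\<exists>a. length (word a) = s \<and> tree_of C a = 1"
    by (intro exI[of _ "word_index (map x [0..<s])"]) (simp add: tree_of_def meets_prefix, simp add: word_word_index)
  then obtain a0 where "length (word a0) = s \<and> tree_of C a0 = 1" by blast
  from ex_has_least_nat[of "\<lambda>a. length (word a) = s \<and> tree_of C a = 1", OF this,
      of "\<lambda>a. word_errors a s"]
  show ?thesis unfolding optimal_word_def by blast
qed

text \<open>Taking oracles from \<open>trees\<close> guarantees that the search for the best word
  terminates.\<close>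

lemma computable_learner_of: "computable_on trees learner_of"
proof -
  have "decidable_on trees (\<lambda>t x. optimal_word t (pfst x) (psnd x))"
    unfolding optimal_word_def by (intro computable_intros)
  then have "computable_on trees best_word"
    unfolding best_word_def
    by (rule computable_Least) (auto simp: trees_def intro: ex_optimal_word)
  then have *: "computable_on trees (\<lambda>t q. best_word t (psnd q))"
    by (rule computable_comp) (intro computable_intros)
  show ?thesis
    unfolding learner_of_def branch_def by (intro computable_intros *)
qed

section \<open>Extending a word to a member of the class\<close>

lemma word_extend:
  "word (b + 2 ^ length (word b)) = word b @ [False]"
  "word (b + 2 * 2 ^ length (word b)) = word b @ [True]"
  by (metis word_index_append[of "word b" "[False]"] word_index_word word_word_index word_index.simps
        mult_0_right add_0 mult.right_neutral,
      metis word_index_append[of "word b" "[True]"] word_index_word word_word_index word_index.simps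
        mult_0_right add_0 mult.commute)

lemma meets_extend:
  assumes "meets C b" "\<not> meets C (b + 2 ^ length (word b))"
  shows "meets C (b + 2 * 2 ^ length (word b))"
proof -
  obtain x where x: "x \<in> cylinder (word b)" "x \<in> C" using assms(1) unfolding meets_def by blast
  then have "x \<in> cylinder (word b @ [x (length (word b))])"
    by (auto simp: cylinder_def nth_append less_Suc_eq)
  then show ?thesis using x(2) assms(2) unfolding meets_def word_extend
    by (cases "x (length (word b))") auto
qed

context
  fixes C :: "cantor set" and a :: nat
  assumes a: "meets C a"
begin

lemma branch_Suc:
  "\<exists>c. word (branch (tree_of C) a (Suc k)) = word (branch (tree_of C) a k) @ [c]"
  unfolding branch_def using word_extend by (simp del: One_nat_def) blast

lemma length_branch: "length (word (branch (tree_of C) a k)) = length (word a) + k"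
proof (induction k)
  case (Suc k)
  then show ?case using branch_Suc[of k] by auto
qed (simp add: branch_def)

lemma branch_prefix: "\<exists>v. word (branch (tree_of C) a (k + j)) = word (branch (tree_of C) a k) @ v"
proof (induction j)
  case (Suc j)
  then show ?case using branch_Suc[of "k + j"] by auto
qed simp

lemma meets_branch: "meets C (branch (tree_of C) a k)"
proof (induction k)
  case (Suc k)
  then show ?case using meets_extend[OF Suc] by (auto simp: branch_def tree_of_def)
qed (simp add: branch_def a)

definition branch_limit :: cantor where
  "branch_limit i = word_bit (branch (tree_of C) a (Suc i)) i"

lemma branch_limit_mem_cylinder: "branch_limit \<in> cylinder (word (branch (tree_of C) a k))"
  unfolding cylinder_def
proof (intro CollectI allI impI)
  fix i assume i: "i < length (word (branch (tree_of C) a k))"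
  have "word (branch (tree_of C) a (Suc i)) ! i = word (branch (tree_of C) a k) ! i"
  \<comment> \<open>Of two stages of the branch the earlier is a prefix of the later, whence both
    agree at position \<open>i\<close>.\<close>
  proof (cases "k \<le> Suc i")
    case True
    then show ?thesis using branch_prefix[of k "Suc i - k"] i by (auto simp: nth_append)
  next
    case False
    then show ?thesis using branch_prefix[of "Suc i" "k - Suc i"] length_branch[of "Suc i"]
      by (auto simp: nth_append)
  qed
  then show "branch_limit i = word (branch (tree_of C) a k) ! i"
    unfolding branch_limit_def using length_branch[of "Suc i"] by (simp add: word_bit)
qed

text \<open>Otherwise some cylinder around the limit misses \<open>C\<close>. A late stage of the
  branch has its cylinder inside that one, although every stage meets \<open>C\<close>.\<close>

lemma branch_limit_mem:
  assumes "closed C"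
  shows "branch_limit \<in> C"
proof (rule ccontr)
  assume "branch_limit \<notin> C"
  then obtain w where w: "branch_limit \<in> cylinder w" "cylinder w \<subseteq> - C"
    using cylinder_basis[of "- C" branch_limit] assms by (auto simp: closed_def)
  have "\<exists>v. word (branch (tree_of C) a (length w)) = w @ v"
    using prefix_of_mem_cylinder[OF w(1) branch_limit_mem_cylinder] length_branch by simp
  then have "cylinder (word (branch (tree_of C) a (length w))) \<subseteq> - C"
    using cylinder_append w(2) by fastforce
  then show False using meets_branch unfolding meets_def by blast
qed

end

text \<open>A competitor \<open>g\<close> has a prefix among the words compared by
  \<open>optimal_word\<close>, and words of that length fix the errors of all their extensions.
  Hence the member of \<open>C\<close> extending the best word errs no more often than
  \<open>g\<close>.\<close>

lemma learner_of_erm: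
  assumes C: "closed C" "C \<noteq> {}"
  shows "\<exists>A. rep_learner (learner_of (tree_of C)) = Some A \<and> empirical_risk_minimizer A C"
proof -
  let ?t = "tree_of C"
  define A where "A S = branch_limit C (best_word ?t (sample_code S))" for S
  have opt: "optimal_word ?t s (best_word ?t s)" for s
    unfolding best_word_def by (rule LeastI_ex[OF ex_optimal_word[OF C(2)]])
  then have m: "meets C (best_word ?t s)" for s
    unfolding optimal_word_def tree_of_def by (metis of_bool_eq_1_iff)
  have AC: "A S \<in> C" for S
    unfolding A_def by (rule branch_limit_mem[OF m C(1)])
  have "empirical_risk S (A S) \<le> empirical_risk S g" if g: "g \<in> C" for S g
  proof -
    let ?s = "sample_code S" and ?n = "word_index (map g [0..<sample_code S])"
    have n: "length (word ?n) = ?s" "?t ?n = 1" "g \<in> cylinder (word ?n)"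
      using meets_prefix[OF g] by (simp_all add: tree_of_def) (simp_all add: word_word_index cylinder_def)
    have "word_errors (best_word ?t ?s) ?s \<le> word_errors ?n ?s"
      using opt[of ?s] n less_of_length_word unfolding optimal_word_def by blast
    moreover have "A S \<in> cylinder (word (best_word ?t ?s))"
      using branch_limit_mem_cylinder[OF m, of ?s 0] unfolding A_def branch_def by simp
    moreover have "length (word (best_word ?t ?s)) = ?s" using opt unfolding optimal_word_def by blast
    ultimately show ?thesis unfolding empirical_risk_def
      using word_errors_sample_code[OF n(3,1)] word_errors_sample_code[of "A S" "best_word ?t ?s" S]
      by (simp add: divide_right_mono)
  qed
  then have "empirical_risk_minimizer A C"
    unfolding empirical_risk_minimizer_def
    by (auto simp: AC intro!: Min_eqI[symmetric] finite_empirical_risk)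
  moreover have "rep_learner (learner_of ?t) = Some A"
    by (auto simp: rep_learner_def learner_of_def query_code_eq A_def branch_limit_def[OF m] fun_eq_iff)
  ultimately show ?thesis by blast
qed

lemma computable_learner_of_tree:
  "computable_on {r \<in> closed_names. rep_closed r \<noteq> Some {}} (\<lambda>r. learner_of (tree_of (the (rep_closed r))))"
proof (rule computable_on_comp_oracle[OF computable_learner_of])
  show "computable_on {r \<in> closed_names. rep_closed r \<noteq> Some {}} (\<lambda>r. tree_of (the (rep_closed r)))"
    using computable_tree_of unfolding computable_on_def by blast
  show "tree_of (the (rep_closed r)) \<in> trees" if "r \<in> {r \<in> closed_names. rep_closed r \<noteq> Some {}}" for r
    using that rep_closedD(3)[of r] unfolding trees_def closed_names_def by force
qed

lemma computable_problem_ERM: "computable_problem ERM"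
proof -
  have "realizes (restrict_to {r \<in> closed_names. rep_closed r \<noteq> Some {}}
    (\<lambda>r. learner_of (tree_of (the (rep_closed r))))) ERM"
    unfolding realizes_def ERM_def restrict_to_def closed_names_def
    using learner_of_erm by (auto split: if_splits)
  then show ?thesis
    unfolding computable_problem_def using computable_restrict_to[OF computable_learner_of_tree] by blast
qed

section \<open>Uniform convergence\<close>

lemma exp_sum_le: "exp x + exp (- x) \<le> 2 * exp (x\<^sup>2 / 2)" for x :: real
proof -
  have *: "exp x + exp (- x) \<le> 2 * exp (x\<^sup>2 / 2)" if "0 \<le> x" for x :: real
  proof -
    \<comment> \<open>The inequality behind Hoeffding's lemma, for a fair coin and range
      \<open>2 * x\<close>. Exponentiating and multiplying by \<open>exp (- x)\<close> gives the
      bound on the hyperbolic cosine.\<close>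
    have "ln (1 + 1/2 * (exp (2 * x) - 1)) \<le> x + x\<^sup>2 / 2"
      using Hoeffdings_lemma_aux[of "2 * x" "1/2"] that by (simp add: power2_eq_square)
    moreover have "1 + 1/2 * (exp (2 * x) - 1) > 0"
      using exp_gt_zero[of "2 * x"] by (simp add: field_simps del: exp_gt_zero)
    ultimately have "1 + 1/2 * (exp (2 * x) - 1) \<le> exp (x + x\<^sup>2 / 2)"
      by (metis exp_le_cancel_iff exp_ln)
    then have "1 + exp (2 * x) \<le> 2 * exp (x + x\<^sup>2 / 2)" by (simp add: field_simps)
    then have "exp (- x) * (1 + exp (2 * x)) \<le> exp (- x) * (2 * exp (x + x\<^sup>2 / 2))"
      by (intro mult_left_mono) auto
    moreover have "exp (- x) * (1 + exp (2 * x)) = exp x + exp (- x)"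
      by (simp add: distrib_left flip: exp_add)
    moreover have "exp (- x) * (2 * exp (x + x\<^sup>2 / 2)) = 2 * (exp (- x) * exp (x + x\<^sup>2 / 2))" by simp
    moreover have "exp (- x) * exp (x + x\<^sup>2 / 2) = exp (x\<^sup>2 / 2)"
      by (simp flip: exp_add)
    ultimately show ?thesis by metis
  qed
  show ?thesis using *[of x] *[of "- x"] by (cases "0 \<le> x") auto
qed

lemma ennreal_mean:
  assumes "0 \<le> a" "0 \<le> b"
  shows "ennreal a * ennreal (1/2) + ennreal b * ennreal (1 - 1/2) = ennreal ((a + b) / 2)"
  using assms ennreal_mult[of a "1/2"] ennreal_mult[of b "1 - 1/2"] ennreal_plus[of "a * (1/2)" "b * (1 - 1/2)"]
  by (simp add: add_divide_distrib)

text \<open>The coins are independent, so the exponential moment factors over the entries. Each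
  factor is the hyperbolic cosine of \<open>l * v\<close>, at most
  \<open>exp (l\<^sup>2 / 2)\<close> since \<open>\<bar>v\<bar> \<le> 1\<close>.\<close>

lemma nn_integral_coin_exp_le:
  fixes vs :: "real list"
  assumes "\<And>v. v \<in> set vs \<Longrightarrow> \<bar>v\<bar> \<le> 1"
  shows "(\<integral>\<^sup>+bs. ennreal (exp (l * sum_list (map2 (\<lambda>b v. if b then - v else v) bs vs)))
           \<partial>replicate_pmf (length vs) (bernoulli_pmf (1/2)))
    \<le> ennreal (exp (real (length vs) * l\<^sup>2 / 2))"
  using assms
proof (induction vs)
  case (Cons v vs)
  let ?P = "replicate_pmf (length vs) (bernoulli_pmf (1/2))"
  let ?g = "\<lambda>bs. exp (l * sum_list (map2 (\<lambda>b v. if b then - v else v) bs vs))"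
  have "(\<integral>\<^sup>+bs. ennreal (exp (l * sum_list (map2 (\<lambda>b v. if b then - v else v) bs (v # vs))))
      \<partial>replicate_pmf (length (v # vs)) (bernoulli_pmf (1/2)))
    = (\<integral>\<^sup>+b. \<integral>\<^sup>+bs. ennreal (exp (l * (if b then - v else v))) * ennreal (?g bs) \<partial>?P \<partial>bernoulli_pmf (1/2))"
    by (simp add: distrib_left exp_add flip: ennreal_mult)
  also have "\<dots> = (\<integral>\<^sup>+b. ennreal (exp (l * (if b then - v else v))) * (\<integral>\<^sup>+bs. ennreal (?g bs) \<partial>?P) \<partial>bernoulli_pmf (1/2))"
    by (simp add: nn_integral_cmult)
  also have "\<dots> = (\<integral>\<^sup>+b. ennreal (exp (l * (if b then - v else v))) \<partial>bernoulli_pmf (1/2)) * (\<integral>\<^sup>+bs. ennreal (?g bs) \<partial>?P)"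
    by (rule nn_integral_multc) simp
  also have "(\<integral>\<^sup>+b. ennreal (exp (l * (if b then - v else v))) \<partial>bernoulli_pmf (1/2))
    = ennreal ((exp (l * v) + exp (- (l * v))) / 2)"
    using ennreal_mean[of "exp (- (l * v))" "exp (l * v)"]
    by (subst nn_integral_bernoulli_pmf) (simp_all add: add.commute)
  also have "ennreal ((exp (l * v) + exp (- (l * v))) / 2) * (\<integral>\<^sup>+bs. ennreal (?g bs) \<partial>?P)
    \<le> ennreal (exp (l\<^sup>2 / 2)) * ennreal (exp (real (length vs) * l\<^sup>2 / 2))"
  proof (intro mult_mono ennreal_leI)
    have "(l * v)\<^sup>2 \<le> l\<^sup>2"
      using Cons.prems[of v] by (simp add: power_mult_distrib mult_left_le abs_square_le_1)
    then have "2 * exp ((l * v)\<^sup>2 / 2) \<le> 2 * exp (l\<^sup>2 / 2)" by simp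
    from order_trans[OF exp_sum_le[of "l * v"] this]
    show "(exp (l * v) + exp (- (l * v))) / 2 \<le> exp (l\<^sup>2 / 2)" by simp
  qed (use Cons in auto)
  also have "\<dots> = ennreal (exp (real (length (v # vs)) * l\<^sup>2 / 2))"
    by (simp add: add_divide_distrib distrib_right flip: ennreal_mult exp_add)
  finally show ?case .
qed simp

section \<open>Double samples and their invariance under swaps\<close>

lemma map_unzip_replicate_pmf:
  "map_pmf (\<lambda>Z. (map fst Z, map snd Z)) (replicate_pmf n (pair_pmf p q))
    = pair_pmf (replicate_pmf n p) (replicate_pmf n q)"
proof (induction n)
  case 0
  show ?case by (simp add: pair_return_pmf1)
next
  case (Suc n)
  have "map_pmf (\<lambda>Z. (map fst Z, map snd Z)) (replicate_pmf (Suc n) (pair_pmf p q))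
    = pair_pmf p q \<bind> (\<lambda>z. map_pmf (\<lambda>Z. (map fst Z, map snd Z)) (replicate_pmf n (pair_pmf p q)) \<bind>
        (\<lambda>(X, Y). return_pmf (fst z # X, snd z # Y)))"
    by (simp add: map_pmf_def bind_assoc_pmf bind_return_pmf)
  also have "\<dots> = p \<bind> (\<lambda>x. q \<bind> (\<lambda>y. replicate_pmf n p \<bind> (\<lambda>X. replicate_pmf n q \<bind>
        (\<lambda>Y. return_pmf (x # X, y # Y)))))"
    unfolding Suc by (simp add: pair_pmf_def bind_assoc_pmf bind_return_pmf)
  \<comment> \<open>Commuting two independent draws puts each head next to its own tail.\<close>
  also have "\<dots> = p \<bind> (\<lambda>x. replicate_pmf n p \<bind> (\<lambda>X. q \<bind> (\<lambda>y. replicate_pmf n q \<bind>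
        (\<lambda>Y. return_pmf (x # X, y # Y)))))"
    by (subst bind_commute_pmf[of q]) simp
  also have "\<dots> = pair_pmf (replicate_pmf (Suc n) p) (replicate_pmf (Suc n) q)"
    by (simp add: pair_pmf_def bind_assoc_pmf bind_return_pmf)
  finally show ?case .
qed

definition swap_where :: "bool list \<Rightarrow> ('a \<times> 'a) list \<Rightarrow> ('a \<times> 'a) list" where
  "swap_where = map2 (\<lambda>b z. if b then prod.swap z else z)"

text \<open>The components of each pair are independent with the same law, so swapping them along a
  fixed pattern preserves the distribution.\<close>

lemma map_swap_where_replicate_pmf:
  "map_pmf (swap_where bs) (replicate_pmf (length bs) (pair_pmf p p)) = replicate_pmf (length bs) (pair_pmf p p)"
proof (induction bs)
  case Nil
  show ?case by (simp add: swap_where_def)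
next
  case (Cons b bs)
  let ?s = "\<lambda>z. if b then prod.swap z else z"
  have swap: "map_pmf ?s (pair_pmf p p) = pair_pmf p p"
    using pair_commute_pmf[of p p] by (cases b) (simp_all add: prod.swap_def case_prod_unfold)
  have "map_pmf (swap_where (b # bs)) (replicate_pmf (length (b # bs)) (pair_pmf p p))
    = map_pmf ?s (pair_pmf p p) \<bind> (\<lambda>z. map_pmf (swap_where bs) (replicate_pmf (length bs) (pair_pmf p p)) \<bind>
        (\<lambda>Z. return_pmf (z # Z)))"
    by (simp add: map_pmf_def bind_assoc_pmf bind_return_pmf swap_where_def)
  also have "\<dots> = replicate_pmf (length (b # bs)) (pair_pmf p p)"
    unfolding swap Cons by simp
  finally show ?case .
qed

lemma nn_integral_pmf_commute:
  fixes f :: "'a \<Rightarrow> 'b \<Rightarrow> ennreal"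
  shows "(\<integral>\<^sup>+x. \<integral>\<^sup>+y. f x y \<partial>measure_pmf q \<partial>measure_pmf p) = (\<integral>\<^sup>+y. \<integral>\<^sup>+x. f x y \<partial>measure_pmf p \<partial>measure_pmf q)"
proof -
  have "(\<integral>\<^sup>+x. \<integral>\<^sup>+y. f x y \<partial>measure_pmf q \<partial>measure_pmf p) = (\<integral>\<^sup>+z. f (fst z) (snd z) \<partial>pair_pmf p q)"
    by (simp add: nn_integral_pair_pmf')
  also have "\<dots> = (\<integral>\<^sup>+y. \<integral>\<^sup>+x. f x y \<partial>measure_pmf p \<partial>measure_pmf q)"
    by (subst pair_commute_pmf) (simp add: nn_integral_pair_pmf' case_prod_unfold)
  finally show ?thesis .
qed

section \<open>Loss patterns and discrepancies on a double sample\<close>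

definition points :: "('a \<times> 'a) list \<Rightarrow> 'a set" where
  "points Z = fst ` set Z \<union> snd ` set Z"

definition discrepancy :: "('a \<Rightarrow> real) \<Rightarrow> ('a \<times> 'a) list \<Rightarrow> real" where
  "discrepancy u Z = (\<Sum>z\<leftarrow>Z. u (snd z) - u (fst z))"

text \<open>\<open>restrict\<close> identifies functions that agree on \<open>X\<close>, so that
  loss patterns are counted by a cardinality.\<close>

definition trace_on :: "('a \<Rightarrow> real) set \<Rightarrow> 'a set \<Rightarrow> ('a \<Rightarrow> real) set" where
  "trace_on F X = (\<lambda>u. restrict u X) ` F"

text \<open>A substitute for the supremum of \<open>\<bar>discrepancy u Z\<bar>\<close> over
  \<open>F\<close>: a finite sum that controls all \<open>u\<close> at once and can be integrated
  term by term.\<close>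

definition exp_discrepancy :: "('a \<Rightarrow> real) set \<Rightarrow> real \<Rightarrow> ('a \<times> 'a) list \<Rightarrow> real" where
  "exp_discrepancy F l Z =
     (\<Sum>u\<in>trace_on F (points Z). exp (l * discrepancy u Z) + exp (- l * discrepancy u Z))"

text \<open>Hence the patterns over which \<open>exp_discrepancy\<close> sums stay fixed while the
  coins vary.\<close>

lemma points_swap_where: "length bs = length Z \<Longrightarrow> points (swap_where bs Z) = points Z"
  by (induction bs Z rule: list_induct2) (auto simp: points_def swap_where_def)

lemma discrepancy_swap_where:
  "length bs = length Z \<Longrightarrow> discrepancy u (swap_where bs Z) =
     sum_list (map2 (\<lambda>b v. if b then - v else v) bs (map (\<lambda>z. u (snd z) - u (fst z)) Z))"
  by (induction bs Z rule: list_induct2) (auto simp: discrepancy_def swap_where_def)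

lemma card_points_le: "finite (points Z) \<and> card (points Z) \<le> 2 * length Z"
proof -
  have "card (points Z) \<le> card (fst ` set Z) + card (snd ` set Z)"
    unfolding points_def by (rule card_Un_le)
  moreover have "card (fst ` set Z) \<le> length Z" "card (snd ` set Z) \<le> length Z"
    using card_image_le[of "set Z"] card_length[of Z] le_trans by blast+
  ultimately show ?thesis by (simp add: points_def)
qed

text \<open>Symmetrization: after averaging over the coins and exchanging the integrals,
  \<open>Z\<close> is fixed and each of at most \<open>N\<close> patterns contributes a sum of terms
  with random signs.\<close>

lemma nn_integral_exp_discrepancy_le:
  fixes F :: "('a \<Rightarrow> real) set"
  assumes F: "\<And>u z. u \<in> F \<Longrightarrow> 0 \<le> u z \<and> u z \<le> 1"
    and N: "\<And>X. finite X \<Longrightarrow> card X \<le> 2 * n \<Longrightarrow> card (trace_on F X) \<le> N"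
  shows "(\<integral>\<^sup>+Z. ennreal (exp_discrepancy F l Z) \<partial>replicate_pmf n (pair_pmf D D))
    \<le> ennreal (2 * real N * exp (real n * l\<^sup>2 / 2))"
proof -
  let ?P = "replicate_pmf n (pair_pmf D D)" and ?B = "replicate_pmf n (bernoulli_pmf (1/2))"
  let ?W = "\<lambda>Z. ennreal (exp_discrepancy F l Z)"
  have len: "length xs = n" if "xs \<in> set_pmf (replicate_pmf n q)" for xs and q :: "'c pmf"
    using that by (simp add: set_replicate_pmf)
  have "(\<integral>\<^sup>+Z. ?W Z \<partial>?P) = (\<integral>\<^sup>+bs. \<integral>\<^sup>+Z. ?W Z \<partial>?P \<partial>?B)" by simp
  also have "\<dots> = (\<integral>\<^sup>+bs. \<integral>\<^sup>+Z. ?W (swap_where bs Z) \<partial>?P \<partial>?B)"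
  \<comment> \<open>The integrand is free of \<open>bs\<close>, which allowed the coins to be
    introduced; for each outcome the swap preserves the law of \<open>Z\<close>.\<close>
  proof (rule nn_integral_cong_AE, rule AE_pmfI)
    fix bs assume "bs \<in> set_pmf ?B"
    then have eq: "map_pmf (swap_where bs) ?P = ?P" using map_swap_where_replicate_pmf[of bs D] len by auto
    show "(\<integral>\<^sup>+Z. ?W Z \<partial>?P) = (\<integral>\<^sup>+Z. ?W (swap_where bs Z) \<partial>?P)"
      using nn_integral_map_pmf[of "swap_where bs" ?P ?W] unfolding eq .
  qed
  also have "\<dots> = (\<integral>\<^sup>+Z. \<integral>\<^sup>+bs. ?W (swap_where bs Z) \<partial>?B \<partial>?P)"
    by (rule nn_integral_pmf_commute)
  also have "\<dots> \<le> (\<integral>\<^sup>+Z. ennreal (2 * real N * exp (real n * l\<^sup>2 / 2)) \<partial>?P)"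
  proof (rule nn_integral_mono_AE, rule AE_pmfI)
    fix Z assume "Z \<in> set_pmf ?P"
    then have Z: "length Z = n" by (rule len)
    let ?T = "trace_on F (points Z)" and ?v = "\<lambda>u. map (\<lambda>z. u (snd z) - u (fst z)) Z"
    let ?d = "\<lambda>u bs. sum_list (map2 (\<lambda>b v. if b then - v else v) bs (?v u))"
    have v: "\<bar>v\<bar> \<le> 1" if u: "u \<in> ?T" and uv: "v \<in> set (?v u)" for u v
    proof -
      obtain z where z: "z \<in> set Z" "v = u (snd z) - u (fst z)" using uv by auto
      obtain w where "w \<in> F" "u = restrict w (points Z)" using u unfolding trace_on_def by blast
      then have "v = w (snd z) - w (fst z)" using z by (simp add: points_def)
      then show ?thesis using F[OF \<open>w \<in> F\<close>, of "snd z"] F[OF \<open>w \<in> F\<close>, of "fst z"] by linarith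
    qed
    \<comment> \<open>The general \<open>k\<close> covers both exponents \<open>l\<close> and
      \<open>- l\<close>.\<close>
    have E: "(\<integral>\<^sup>+bs. ennreal (exp (k * ?d u bs)) \<partial>?B) \<le> ennreal (exp (real n * l\<^sup>2 / 2))"
      if "u \<in> ?T" "k\<^sup>2 = l\<^sup>2" for u k
      using nn_integral_coin_exp_le[of "?v u" k] v[OF that(1)] Z that(2) by simp
    have "(\<integral>\<^sup>+bs. ?W (swap_where bs Z) \<partial>?B)
      = (\<integral>\<^sup>+bs. (\<Sum>u\<in>?T. ennreal (exp (l * ?d u bs)) + ennreal (exp (- l * ?d u bs))) \<partial>?B)"
    proof (rule nn_integral_cong_AE, rule AE_pmfI)
      fix bs assume "bs \<in> set_pmf ?B"
      then have "length bs = length Z" using len Z by simp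
      then show "?W (swap_where bs Z) = (\<Sum>u\<in>?T. ennreal (exp (l * ?d u bs)) + ennreal (exp (- l * ?d u bs)))"
        unfolding exp_discrepancy_def by (simp add: points_swap_where discrepancy_swap_where add_nonneg_nonneg flip: sum_ennreal)
    qed
    also have "\<dots> = (\<Sum>u\<in>?T. (\<integral>\<^sup>+bs. ennreal (exp (l * ?d u bs)) \<partial>?B) + (\<integral>\<^sup>+bs. ennreal (exp (- l * ?d u bs)) \<partial>?B))"
      by (simp add: nn_integral_sum nn_integral_add)
    also have "\<dots> \<le> (\<Sum>u\<in>?T. ennreal (exp (real n * l\<^sup>2 / 2)) + ennreal (exp (real n * l\<^sup>2 / 2)))"
      by (intro sum_mono add_mono E) auto
    also have "\<dots> = ennreal (real (card ?T) * (2 * exp (real n * l\<^sup>2 / 2)))"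
      by (simp add: ennreal_mult ennreal_of_nat_eq_real_of_nat flip: ennreal_plus)
    also have "\<dots> \<le> ennreal (2 * real N * exp (real n * l\<^sup>2 / 2))"
      using N[of "points Z"] card_points_le[of Z] Z by (intro ennreal_leI) simp
    finally show "(\<integral>\<^sup>+bs. ?W (swap_where bs Z) \<partial>?B) \<le> ennreal (2 * real N * exp (real n * l\<^sup>2 / 2))" .
  qed
  finally show ?thesis by simp
qed

text \<open>This is \<open>y \<le> exp y\<close> at \<open>y = l * (\<bar>x\<bar> - t)\<close>,
  where \<open>x\<close> is the discrepancy of \<open>u\<close>. It equals that of the restriction
  of \<open>u\<close>, which is one of the summands.\<close>

lemma abs_discrepancy_le:
  assumes "0 < l" "u \<in> F" "finite (trace_on F (points Z))"
  shows "\<bar>discrepancy u Z\<bar> \<le> t + exp (- l * t) / l * exp_discrepancy F l Z"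
proof -
  let ?x = "discrepancy u Z" and ?w = "restrict u (points Z)"
  have "discrepancy ?w Z = ?x"
    unfolding discrepancy_def by (intro arg_cong[of _ _ sum_list] map_cong refl) (auto simp: points_def)
  moreover have "?w \<in> trace_on F (points Z)" using assms(2) unfolding trace_on_def by blast
  ultimately have W: "exp (l * ?x) + exp (- l * ?x) \<le> exp_discrepancy F l Z"
    unfolding exp_discrepancy_def
    using member_le_sum[of ?w "trace_on F (points Z)" "\<lambda>u. exp (l * discrepancy u Z) + exp (- l * discrepancy u Z)"] assms(3)
    by (simp add: add_nonneg_nonneg)
  have "l * (\<bar>?x\<bar> - t) \<le> exp (l * (\<bar>?x\<bar> - t))"
    using exp_ge_add_one_self[of "l * (\<bar>?x\<bar> - t)"] by linarith
  also have "\<dots> = exp (- l * t) * exp (l * \<bar>?x\<bar>)" by (simp add: algebra_simps flip: exp_add)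
  also have "\<dots> \<le> exp (- l * t) * exp_discrepancy F l Z"
  proof (rule mult_left_mono[OF order_trans[OF _ W]])
    show "exp (l * \<bar>?x\<bar>) \<le> exp (l * ?x) + exp (- l * ?x)" by (cases "0 \<le> ?x") auto
  qed simp
  finally show ?thesis using assms(1) by (simp add: field_simps)
qed

section \<open>Deviation of sample means from the expectation\<close>

lemma expectation_sum_replicate_pmf:
  fixes u :: "'a \<Rightarrow> real"
  assumes u: "\<And>z. 0 \<le> u z \<and> u z \<le> 1"
  shows "integrable (replicate_pmf n D) (\<lambda>S. \<Sum>z\<leftarrow>S. u z)"
    and "measure_pmf.expectation (replicate_pmf n D) (\<lambda>S. \<Sum>z\<leftarrow>S. u z) = real n * measure_pmf.expectation D u"
proof -
  have nonneg: "0 \<le> (\<Sum>z\<leftarrow>S. u z)" for S by (rule sum_list_nonneg) (use u in auto)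
  have le: "(\<Sum>z\<leftarrow>S. u z) \<le> real (length S)" for S
    by (induction S) (use u in \<open>auto intro: add_mono\<close>)
  show "integrable (replicate_pmf n D) (\<lambda>S. \<Sum>z\<leftarrow>S. u z)"
  proof (rule measure_pmf.integrable_const_bound[where B = "real n"], rule AE_pmfI)
    fix S assume "S \<in> set_pmf (replicate_pmf n D)"
    then show "norm (\<Sum>z\<leftarrow>S. u z) \<le> real n"
      using nonneg[of S] le[of S] by (auto simp: set_replicate_pmf)
  qed simp
  have D: "(\<integral>\<^sup>+z. ennreal (u z) \<partial>D) = ennreal (measure_pmf.expectation D u)"
    by (intro nn_integral_eq_integral measure_pmf.integrable_const_bound[where B = 1]) (use u in auto)
  have E: "0 \<le> measure_pmf.expectation D u" using u by simp
  have "(\<integral>\<^sup>+S. ennreal (\<Sum>z\<leftarrow>S. u z) \<partial>replicate_pmf n D) = ennreal (real n * measure_pmf.expectation D u)"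
  \<comment> \<open>The induction runs on nonnegative integrals in \<open>ennreal\<close>; the value
    is carried over to the expectation at the end.\<close>
  proof (induction n)
    case (Suc n)
    have "(\<integral>\<^sup>+S. ennreal (\<Sum>z\<leftarrow>S. u z) \<partial>replicate_pmf (Suc n) D)
      = (\<integral>\<^sup>+z. (\<integral>\<^sup>+S. ennreal (u z) + ennreal (\<Sum>z\<leftarrow>S. u z) \<partial>replicate_pmf n D) \<partial>D)"
      by (simp add: u nonneg)
    also have "\<dots> = (\<integral>\<^sup>+z. ennreal (u z) \<partial>D) + (\<integral>\<^sup>+S. ennreal (\<Sum>z\<leftarrow>S. u z) \<partial>replicate_pmf n D)"
      by (simp add: nn_integral_add)
    also have "\<dots> = ennreal (real (Suc n) * measure_pmf.expectation D u)"
      unfolding D Suc using E by (simp add: distrib_right flip: ennreal_plus)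
    finally show ?case .
  qed simp
  then show "measure_pmf.expectation (replicate_pmf n D) (\<lambda>S. \<Sum>z\<leftarrow>S. u z) = real n * measure_pmf.expectation D u"
    using E nonneg by (subst integral_eq_nn_integral) auto
qed

lemma discrepancy_zip:
  "length S = length S' \<Longrightarrow> discrepancy u (zip S S') = (\<Sum>z\<leftarrow>S'. u z) - (\<Sum>z\<leftarrow>S. u z)"
  by (induction S S' rule: list_induct2) (auto simp: discrepancy_def)

text \<open>\<open>n\<close> times the expectation is the mean of the sum over a second sample, so
  the deviation is at most the mean absolute discrepancy. The right-hand side is free of
  \<open>u\<close>, which makes the bound uniform.\<close>

lemma deviation_le:
  fixes F :: "('a \<Rightarrow> real) set"
  assumes F: "\<And>u z. u \<in> F \<Longrightarrow> 0 \<le> u z \<and> u z \<le> 1"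
    and fin: "\<And>X. finite X \<Longrightarrow> finite (trace_on F X)"
    and "0 < l" "0 \<le> t" "u \<in> F" "length S = n"
  shows "ennreal \<bar>real n * measure_pmf.expectation D u - (\<Sum>z\<leftarrow>S. u z)\<bar>
    \<le> ennreal t + ennreal (exp (- l * t) / l) *
        (\<integral>\<^sup>+S'. ennreal (exp_discrepancy F l (zip S S')) \<partial>replicate_pmf n D)"
proof -
  let ?P = "replicate_pmf n D" and ?W = "\<lambda>S'. exp_discrepancy F l (zip S S')"
  note E = expectation_sum_replicate_pmf[of u n D, OF F[OF \<open>u \<in> F\<close>]]
  have W: "0 \<le> ?W S'" for S'
    unfolding exp_discrepancy_def by (intro sum_nonneg add_nonneg_nonneg) auto
  have "real n * measure_pmf.expectation D u - (\<Sum>z\<leftarrow>S. u z)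
    = measure_pmf.expectation ?P (\<lambda>S'. (\<Sum>z\<leftarrow>S'. u z) - (\<Sum>z\<leftarrow>S. u z))"
    using E by simp
  also have "ennreal \<bar>\<dots>\<bar> \<le> (\<integral>\<^sup>+S'. norm ((\<Sum>z\<leftarrow>S'. u z) - (\<Sum>z\<leftarrow>S. u z)) \<partial>?P)"
    using integral_norm_bound_ennreal[of ?P "\<lambda>S'. (\<Sum>z\<leftarrow>S'. u z) - (\<Sum>z\<leftarrow>S. u z)"] E(1) by simp
  also have "\<dots> \<le> (\<integral>\<^sup>+S'. ennreal t + ennreal (exp (- l * t) / l) * ennreal (?W S') \<partial>?P)"
  proof (rule nn_integral_mono_AE, rule AE_pmfI)
    fix S' assume "S' \<in> set_pmf ?P"
    then have "norm ((\<Sum>z\<leftarrow>S'. u z) - (\<Sum>z\<leftarrow>S. u z)) = \<bar>discrepancy u (zip S S')\<bar>"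
      using \<open>length S = n\<close> by (simp add: set_replicate_pmf discrepancy_zip)
    also have "\<dots> \<le> t + exp (- l * t) / l * ?W S'"
      using assms(3,5) card_points_le fin by (intro abs_discrepancy_le) auto
    finally have "ennreal (norm ((\<Sum>z\<leftarrow>S'. u z) - (\<Sum>z\<leftarrow>S. u z))) \<le> ennreal (t + exp (- l * t) / l * ?W S')"
      by (rule ennreal_leI)
    also have "\<dots> = ennreal t + ennreal (exp (- l * t) / l) * ennreal (?W S')"
      using W[of S'] assms(3,4) by (simp flip: ennreal_plus ennreal_mult)
    finally show "ennreal (norm ((\<Sum>z\<leftarrow>S'. u z) - (\<Sum>z\<leftarrow>S. u z)))
      \<le> ennreal t + ennreal (exp (- l * t) / l) * ennreal (?W S')" .
  qed
  also have "\<dots> = ennreal t + ennreal (exp (- l * t) / l) * (\<integral>\<^sup>+S'. ennreal (?W S') \<partial>?P)"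
    by (simp add: nn_integral_add nn_integral_cmult)
  finally show ?thesis .
qed

text \<open>\<open>deviation_le\<close> is applied with \<open>l = e\<close> and
  \<open>t = n * e\<close>, followed by Markov's inequality for the mean of
  \<open>exp_discrepancy\<close> over the second sample.\<close>

lemma uniform_convergence:
  fixes F :: "('a \<Rightarrow> real) set"
  assumes F: "\<And>u z. u \<in> F \<Longrightarrow> 0 \<le> u z \<and> u z \<le> 1"
    and fin: "\<And>X. finite X \<Longrightarrow> finite (trace_on F X)"
    and N: "\<And>X. finite X \<Longrightarrow> card X \<le> 2 * n \<Longrightarrow> card (trace_on F X) \<le> N"
    and "0 < e" "0 < n"
  shows "measure_pmf.prob (replicate_pmf n D)
      {S. \<exists>u\<in>F. \<bar>measure_pmf.expectation D u - (\<Sum>z\<leftarrow>S. u z) / real n\<bar> > 2 * e}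
    \<le> 2 * real N * exp (- (real n * e\<^sup>2 / 2)) / (real n * e\<^sup>2)"
proof -
  let ?P = "replicate_pmf n D"
  let ?bad = "{S. \<exists>u\<in>F. \<bar>measure_pmf.expectation D u - (\<Sum>z\<leftarrow>S. u z) / real n\<bar> > 2 * e}"
  define w where "w S = (\<integral>\<^sup>+S'. ennreal (exp_discrepancy F e (zip S S')) \<partial>?P)" for S
  \<comment> \<open>This is the factor \<open>exp (- l * t) / l\<close> divided by \<open>t\<close>,
    for the chosen \<open>l\<close> and \<open>t\<close>.\<close>
  define c where "c = exp (- (real n * e\<^sup>2)) / (real n * e\<^sup>2)"
  have c: "0 \<le> c" unfolding c_def by simp
  \<comment> \<open>If \<open>c * w S\<close> were below \<open>1\<close>, both summands of the
    bound would be at most \<open>n * e\<close>, and the deviation of the mean at most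
    \<open>2 * e\<close>.\<close>
  have bad: "1 \<le> ennreal c * w S" if S: "S \<in> set_pmf ?P" "S \<in> ?bad" for S
  proof (rule ccontr)
    assume "\<not> 1 \<le> ennreal c * w S"
    obtain u where u: "u \<in> F" "\<bar>measure_pmf.expectation D u - (\<Sum>z\<leftarrow>S. u z) / real n\<bar> > 2 * e"
      using S(2) by blast
    have "ennreal \<bar>real n * measure_pmf.expectation D u - (\<Sum>z\<leftarrow>S. u z)\<bar>
        \<le> ennreal (real n * e) + ennreal (exp (- e * (real n * e)) / e) * w S"
      unfolding w_def using S(1) assms(4) u(1)
      by (intro deviation_le F fin) (auto simp: set_replicate_pmf)
    also have "exp (- e * (real n * e)) / e = real n * e * c"
      unfolding c_def using assms(4,5) by (simp add: power2_eq_square field_simps)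
    also have "ennreal (real n * e * c) * w S = ennreal (real n * e) * (ennreal c * w S)"
      unfolding ennreal_mult''[OF c] by (rule mult.assoc)
    also have "ennreal (real n * e) + \<dots> \<le> ennreal (real n * e) + ennreal (real n * e) * 1"
      using \<open>\<not> 1 \<le> ennreal c * w S\<close> by (intro add_left_mono mult_left_mono) auto
    also have "\<dots> = ennreal (real n * e + real n * e)"
      using assms(4) by (subst ennreal_plus) simp_all
    finally have "\<bar>real n * measure_pmf.expectation D u - (\<Sum>z\<leftarrow>S. u z)\<bar> \<le> real n * e + real n * e"
      using assms(4) by (simp add: ennreal_le_iff)
    moreover have "real n * measure_pmf.expectation D u - (\<Sum>z\<leftarrow>S. u z)
        = real n * (measure_pmf.expectation D u - (\<Sum>z\<leftarrow>S. u z) / real n)"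
      using assms(5) by (simp add: field_simps)
    ultimately have "real n * \<bar>measure_pmf.expectation D u - (\<Sum>z\<leftarrow>S. u z) / real n\<bar> \<le> real n * (2 * e)"
      by (simp add: abs_mult mult.commute mult.left_commute)
    then show False using u(2) assms(5) by simp
  qed
  \<comment> \<open>The fact \<open>bad\<close> concerns samples in the support, which have length
    \<open>n\<close>.\<close>
  have "emeasure ?P ?bad = emeasure ?P (?bad \<inter> set_pmf ?P)" by (rule emeasure_Int_set_pmf[symmetric])
  also have "\<dots> \<le> emeasure ?P {S\<in>UNIV. 1 \<le> ennreal c * w S}"
    by (rule emeasure_mono) (use bad in auto)
  also have "\<dots> \<le> ennreal c * (\<integral>\<^sup>+S. w S * indicator UNIV S \<partial>?P)"
    by (rule nn_integral_Markov_inequality) auto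
  also have "(\<integral>\<^sup>+S. w S * indicator UNIV S \<partial>?P)
      = (\<integral>\<^sup>+Z. ennreal (exp_discrepancy F e (zip (fst Z) (snd Z))) \<partial>pair_pmf ?P ?P)"
    unfolding w_def by (simp add: nn_integral_pair_pmf')
  also have "\<dots> = (\<integral>\<^sup>+Z. ennreal (exp_discrepancy F e Z) \<partial>replicate_pmf n (pair_pmf D D))"
    unfolding map_unzip_replicate_pmf[symmetric] by (simp add: zip_map_fst_snd)
  also have "ennreal c * \<dots> \<le> ennreal c * ennreal (2 * real N * exp (real n * e\<^sup>2 / 2))"
    by (intro mult_left_mono nn_integral_exp_discrepancy_le F N) auto
  also have "\<dots> = ennreal (c * (2 * real N * exp (real n * e\<^sup>2 / 2)))"
    using c by (simp add: ennreal_mult'')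
  also have "c * (2 * real N * exp (real n * e\<^sup>2 / 2)) = 2 * real N * exp (- (real n * e\<^sup>2 / 2)) / (real n * e\<^sup>2)"
  proof -
    have "exp (- (real n * e\<^sup>2)) * exp (real n * e\<^sup>2 / 2) = exp (- (real n * e\<^sup>2 / 2))"
      by (simp flip: exp_add)
    then show ?thesis unfolding c_def by (simp add: mult.commute mult.left_commute)
  qed
  finally show ?thesis
    by (simp add: measure_pmf.emeasure_eq_measure)
qed

section \<open>Empirical risk minimizers learn classes of finite VC dimension\<close>

text \<open>Pajor's form of the Sauer-Shelah lemma, which is the one that can be proved by induction.\<close>

lemma card_le_card_shattered:
  assumes "finite X" "F \<subseteq> Pow X"
  shows "card F \<le> card {A. A \<subseteq> X \<and> Pow A \<subseteq> (\<lambda>B. B \<inter> A) ` F}"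
  using assms
proof (induction X arbitrary: F rule: finite_induct)
  case empty
  then consider "F = {}" | "F = {{}}" by auto
  then show ?case
  proof cases
    case 2
    have "{A. A \<subseteq> {} \<and> Pow A \<subseteq> (\<lambda>B. B \<inter> A) ` {{}}} = {{}::'a set}" by auto
    then show ?thesis unfolding 2 by (simp only: order_refl)
  qed simp
next
  case (insert x X)
  let ?sh = "\<lambda>X F. {A. A \<subseteq> X \<and> Pow A \<subseteq> (\<lambda>B. B \<inter> A) ` F}"
  \<comment> \<open>\<open>F\<close> has as many members as \<open>P\<close> and \<open>Q\<close>
    together, hence as \<open>P \<union> Q\<close> and \<open>P \<inter> Q\<close> together. What
    \<open>P \<union> Q\<close> shatters is shattered by \<open>F\<close>, and what
    \<open>P \<inter> Q\<close> shatters remains so after adding \<open>x\<close>.\<close>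
  define P where "P = {B \<in> F. x \<notin> B}"
  define Q where "Q = (\<lambda>B. B - {x}) ` {B \<in> F. x \<in> B}"
  have PQ: "P \<subseteq> Pow X" "Q \<subseteq> Pow X" using insert.prems unfolding P_def Q_def by auto
  then have fin: "finite P" "finite Q" using insert.hyps(1) by (meson finite_Pow_iff finite_subset)+
  have finF: "finite F" using insert.prems insert.hyps(1) by (meson finite_Pow_iff finite_insert finite_subset)
  have "inj_on (\<lambda>B. B - {x}) {B \<in> F. x \<in> B}" by (auto simp: inj_on_def)
  then have "card Q = card {B \<in> F. x \<in> B}" unfolding Q_def by (rule card_image)
  moreover have "F = P \<union> {B \<in> F. x \<in> B}" "P \<inter> {B \<in> F. x \<in> B} = {}" unfolding P_def by auto
  ultimately have "card F = card P + card Q" using finF by (metis card_Un_disjoint finite_Un)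
  also have "\<dots> = card (P \<union> Q) + card (P \<inter> Q)" by (rule card_Un_Int[OF fin])
  also have "\<dots> \<le> card (?sh X (P \<union> Q)) + card (?sh X (P \<inter> Q))"
    using PQ by (intro add_mono insert.IH) auto
  also have "card (?sh X (P \<inter> Q)) = card (insert x ` ?sh X (P \<inter> Q))"
    using insert.hyps(2) by (intro card_image[symmetric]) (auto simp: inj_on_def)
  also have "card (?sh X (P \<union> Q)) + \<dots> = card (?sh X (P \<union> Q) \<union> insert x ` ?sh X (P \<inter> Q))"
    using insert.hyps by (intro card_Un_disjoint[symmetric]) auto
  also have "\<dots> \<le> card (?sh (insert x X) F)"
  proof (rule card_mono)
    show "finite (?sh (insert x X) F)" using insert.hyps(1) by simp
    have 1: "A \<in> ?sh (insert x X) F" if "A \<in> ?sh X (P \<union> Q)" for A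
    proof -
      have sub: "Pow A \<subseteq> (\<lambda>B. B \<inter> A) ` (P \<union> Q)" and A: "A \<subseteq> X" "x \<notin> A"
        using that insert.hyps(2) by blast+
      have "T \<in> (\<lambda>B. B \<inter> A) ` F" if "T \<subseteq> A" for T
      proof -
        have "T \<in> (\<lambda>B. B \<inter> A) ` (P \<union> Q)" using sub that by (meson PowI subsetD)
        then obtain B where B: "B \<in> P \<union> Q" "T = B \<inter> A" by (rule imageE)
        then obtain B' where "B' \<in> F" "B' - {x} = B - {x}" unfolding P_def Q_def by auto
        then have "T = B' \<inter> A" using A(2) B(2) by blast
        then show ?thesis using \<open>B' \<in> F\<close> by blast
      qed
      then show ?thesis using A(1) by (simp add: subset_insertI2 subset_iff)
    qed
    have 2: "insert x A \<in> ?sh (insert x X) F" if "A \<in> ?sh X (P \<inter> Q)" for A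
    proof -
      have sub: "Pow A \<subseteq> (\<lambda>B. B \<inter> A) ` (P \<inter> Q)" and A: "A \<subseteq> X" "x \<notin> A"
        using that insert.hyps(2) by blast+
      have "T \<in> (\<lambda>B. B \<inter> insert x A) ` F" if "T \<subseteq> insert x A" for T
      proof -
        have "T - {x} \<in> (\<lambda>B. B \<inter> A) ` (P \<inter> Q)" by (rule subsetD[OF sub]) (use that in auto)
        then obtain B where B: "B \<in> P" "B \<in> Q" "T - {x} = B \<inter> A" by auto
        from B(2) have "insert x B \<in> F" unfolding Q_def by (auto simp: insert_absorb)
        show ?thesis
        proof (cases "x \<in> T")
          case True
          then have "T = insert x B \<inter> insert x A" using B(3) by auto
          then show ?thesis using \<open>insert x B \<in> F\<close> by blast
        next
          case False
          then have "T = B \<inter> insert x A" "B \<in> F" using B unfolding P_def by auto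
          then show ?thesis by blast
        qed
      qed
      then show ?thesis using A(1) by (simp add: subset_insertI2 subset_iff)
    qed
    show "?sh X (P \<union> Q) \<union> insert x ` ?sh X (P \<inter> Q) \<subseteq> ?sh (insert x X) F"
      by (rule Un_least[OF subsetI[OF 1] image_subsetI[OF 2]])
  qed
  finally show ?case .
qed

text \<open>A nonempty subset of size at most \<open>Suc d\<close> arises by inserting a point of
  \<open>X\<close> into one of size at most \<open>d\<close>, so each step costs a factor
  \<open>card X + 1\<close>.\<close>

lemma card_small_subsets_le:
  assumes "finite X"
  shows "card {A. A \<subseteq> X \<and> card A \<le> d} \<le> (card X + 1) ^ d"
proof (induction d)
  case 0
  have "{A. A \<subseteq> X \<and> card A \<le> 0} = {{}}"
    using assms by (auto dest: finite_subset)
  then show ?case by simp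
next
  case (Suc d)
  let ?S = "\<lambda>d. {A. A \<subseteq> X \<and> card A \<le> d}"
  have fin: "finite (?S d)" using assms by simp
  have "?S (Suc d) \<subseteq> (\<lambda>(x, A). insert x A) ` (X \<times> ?S d) \<union> ?S d"
  proof
    fix A assume A: "A \<in> ?S (Suc d)"
    show "A \<in> (\<lambda>(x, A). insert x A) ` (X \<times> ?S d) \<union> ?S d"
    proof (cases "A = {}")
      case False
      then obtain x where "x \<in> A" by blast
      moreover have "finite A" using A assms finite_subset by blast
      ultimately have "(x, A - {x}) \<in> X \<times> ?S d" "A = insert x (A - {x})"
        using A by auto
      then show ?thesis by (intro UnI1 image_eqI[of _ _ "(x, A - {x})"]) auto
    qed auto
  qed
  then have "card (?S (Suc d)) \<le> card ((\<lambda>(x, A). insert x A) ` (X \<times> ?S d) \<union> ?S d)"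
    using assms fin by (intro card_mono) auto
  also have "\<dots> \<le> card ((\<lambda>(x, A). insert x A) ` (X \<times> ?S d)) + card (?S d)" by (rule card_Un_le)
  also have "\<dots> \<le> card (X \<times> ?S d) + card (?S d)"
    using assms fin by (intro add_right_mono card_image_le) auto
  also have "\<dots> = (card X + 1) * card (?S d)" by (simp add: card_cartesian_product)
  also have "\<dots> \<le> (card X + 1) * (card X + 1) ^ d" using Suc by (rule mult_left_mono) simp
  finally show ?case by simp
qed

text \<open>A set shattered by the traces on \<open>X\<close> is shattered by \<open>C\<close> and
  hence has at most \<open>d\<close> elements; it remains to count small subsets of
  \<open>X\<close>.\<close>

lemma Sauer_Shelah:
  assumes "VCdim C \<le> enat d" "finite X"
  shows "card ((\<lambda>B. {n. B n} \<inter> X) ` C) \<le> (card X + 1) ^ d"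
proof -
  let ?F = "(\<lambda>B. {n. B n} \<inter> X) ` C"
  have "card A \<le> d" if A: "A \<subseteq> X" "Pow A \<subseteq> (\<lambda>B. B \<inter> A) ` ?F" for A
  proof -
    have fin: "finite A" using A(1) assms(2) finite_subset by blast
    have "(\<lambda>B. {n. B n} \<inter> A) ` C = Pow A"
    proof
      have "{n. B n} \<inter> X \<inter> A = {n. B n} \<inter> A" for B using A(1) by blast
      then show "Pow A \<subseteq> (\<lambda>B. {n. B n} \<inter> A) ` C" using A(2) by (simp add: image_image)
    qed auto
    then have "shatters C A" unfolding shatters_def using fin by (simp add: card_Pow)
    then have "enat (card A) \<le> VCdim C" unfolding VCdim_def using fin by (intro SUP_upper) auto
    then show ?thesis using assms(1) by (metis enat_ord_simps(1) order_trans)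
  qed
  then have "card {A. A \<subseteq> X \<and> Pow A \<subseteq> (\<lambda>B. B \<inter> A) ` ?F} \<le> card {A. A \<subseteq> X \<and> card A \<le> d}"
    using assms(2) by (intro card_mono) auto
  moreover have "?F \<subseteq> Pow X" by blast
  ultimately show ?thesis
    using card_le_card_shattered[OF assms(2)] card_small_subsets_le[OF assms(2)] by (meson order_trans)
qed

section \<open>Zero-one loss, risk and the sample size\<close>

definition loss :: "cantor \<Rightarrow> nat \<times> bool \<Rightarrow> real" where
  "loss h z = of_bool (h (fst z) \<noteq> snd z)"

text \<open>On \<open>X\<close> the loss of a hypothesis depends only on its values at the first
  components, so there are no more loss patterns than traces of \<open>C\<close> there.\<close>

lemma trace_on_loss:
  assumes "finite X"
  shows "finite (trace_on (loss ` C) X)"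
    and "VCdim C \<le> enat d \<Longrightarrow> card (trace_on (loss ` C) X) \<le> (card X + 1) ^ d"
proof -
  let ?F = "(\<lambda>B. {n. B n} \<inter> fst ` X) ` C"
  let ?r = "\<lambda>T. restrict (\<lambda>z. of_bool ((fst z \<in> T) \<noteq> snd z)) X :: nat \<times> bool \<Rightarrow> real"
  have "restrict (loss B) X = ?r ({n. B n} \<inter> fst ` X)" for B
    by (rule restrict_ext) (simp add: loss_def)
  then have eq: "trace_on (loss ` C) X = ?r ` ?F" unfolding trace_on_def image_image by simp
  have fin: "finite ?F" by (rule finite_subset[of _ "Pow (fst ` X)"]) (use assms in auto)
  show "finite (trace_on (loss ` C) X)" unfolding eq using fin by simp
  assume "VCdim C \<le> enat d"
  then have "card ?F \<le> (card (fst ` X) + 1) ^ d" using assms by (intro Sauer_Shelah) auto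
  also have "\<dots> \<le> (card X + 1) ^ d" using card_image_le[OF assms, of fst] by (intro power_mono) auto
  finally show "card (trace_on (loss ` C) X) \<le> (card X + 1) ^ d"
    unfolding eq using card_image_le[OF fin, of ?r] by simp
qed

lemma risk_eq_expectation: "risk D h = measure_pmf.expectation D (loss h)"
proof -
  let ?A = "{z. h (fst z) \<noteq> snd z}"
  have "risk D h = infsum (pmf D) ?A"
    unfolding risk_def by (rule infsum_cong_neutral) auto
  also have "\<dots> = measure_pmf.prob D ?A"
    by (simp add: measure_pmf_conv_infsetsum infsetsum_infsum pmf_abs_summable)
  also have "\<dots> = measure_pmf.expectation D (indicator ?A)" by simp
  also have "indicator ?A = loss h" by (auto simp: loss_def fun_eq_iff indicator_def)
  finally show ?thesis .
qed

lemma empirical_risk_eq_sum: "empirical_risk S h = (\<Sum>z\<leftarrow>S. loss h z) / real (length S)"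
proof -
  have "(\<Sum>z\<leftarrow>S. loss h z) = (\<Sum>k<length S. of_bool (h (fst (S ! k)) \<noteq> snd (S ! k)))"
    by (simp add: sum_list_sum_nth loss_def atLeast0LessThan)
  also have "\<dots> = real (card ({..<length S} \<inter> {k. h (fst (S ! k)) \<noteq> snd (S ! k)}))"
    by (simp add: sum_of_bool_eq)
  also have "{..<length S} \<inter> {k. h (fst (S ! k)) \<noteq> snd (S ! k)} = {k. k < length S \<and> h (fst (S ! k)) \<noteq> snd (S ! k)}"
    by auto
  finally show ?thesis unfolding empirical_risk_def by simp
qed

text \<open>
  The argument \<open>k\<close> is \<open>cantor_pair i j\<close> itself: since it bounds \<open>i\<close> and \<open>j\<close>, it need not be decoded.
\<close>

definition sample_bound :: "nat \<Rightarrow> nat \<Rightarrow> nat" where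
  "sample_bound d k = (12 * (d + 1)) ^ (d + 1) * 2 ^ ((k + 2) * (2 * d + 4))"

text \<open>The exponential yields a power \<open>d + 1\<close> of \<open>n\<close> in the
  denominator and the explicit division one more, against \<open>n ^ d\<close> from the patterns.
  What remains is at most \<open>m / n\<^sup>2\<close>, and \<open>sample_bound\<close> is chosen to
  be this constant \<open>m\<close>.\<close>

lemma sample_bound_suffices:
  assumes n: "sample_bound d k \<le> n" and "j \<le> k"
  defines "e \<equiv> 1 / 2 ^ (k + 2) :: real"
  shows "2 * real ((2 * n + 1) ^ d) * exp (- (real n * e\<^sup>2 / 2)) / (real n * e\<^sup>2) < 1 / 2 ^ j"
proof -
  define q :: real where "q = 2 ^ (2 * (k + 2))"
  define m where "m = real (sample_bound d k)"
  define x where "x = real n / (2 * q)"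
  let ?D = "real (d + 1)"
  have q: "0 < q" unfolding q_def by simp
  have e: "e\<^sup>2 = 1 / q" unfolding e_def q_def by (simp add: power_divide power_mult[symmetric] mult.commute)
  have m: "m = (12 * ?D) ^ (d + 1) * q ^ (d + 2)"
  proof -
    have "(2 * (k + 2)) * (d + 2) = (k + 2) * (2 * d + 4)" by (simp add: algebra_simps)
    then have "q ^ (d + 2) = 2 ^ ((k + 2) * (2 * d + 4))" unfolding q_def by (simp only: power_mult[symmetric])
    then show ?thesis unfolding m_def sample_bound_def by simp
  qed
  have "2 ^ ((k + 2) * (2 * d + 4)) \<le> sample_bound d k" unfolding sample_bound_def by simp
  then have "real (2 ^ ((k + 2) * (2 * d + 4))) \<le> m" unfolding m_def by (rule of_nat_mono)
  then have "2 ^ ((k + 2) * (2 * d + 4)) \<le> m" by (simp only: of_nat_power of_nat_numeral)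
  moreover have "(2::real) ^ j < 2 ^ ((k + 2) * (2 * d + 4))"
    using assms(2) by (intro power_strict_increasing) (auto simp: algebra_simps)
  ultimately have mj: "2 ^ j < m" by (rule less_le_trans[rotated])
  then have m0: "0 < m" by (smt (verit) zero_less_power)
  have mn: "m \<le> real n" unfolding m_def using n by simp
  with m0 have n0: "0 < real n" by linarith
  have x: "0 < x" unfolding x_def using n0 q by simp
  have xe: "real n * e\<^sup>2 = 2 * x" unfolding e x_def by simp
  \<comment> \<open>\<open>(1 + x / N) ^ N \<le> exp x\<close> for \<open>N = d + 1\<close> gives
    the polynomial lower bound on \<open>exp x\<close>.\<close>
  have "(x / ?D) ^ (d + 1) \<le> (1 + x / ?D) ^ (d + 1)"
    using x by (intro power_mono) auto
  also have "\<dots> \<le> exp x"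
    using exp_ge_one_plus_x_over_n_power_n[of "d + 1" x] x by simp
  finally have "inverse (exp x) \<le> inverse ((x / ?D) ^ (d + 1))"
    using x by (intro le_imp_inverse_le) auto
  also have "\<dots> = (?D / x) ^ (d + 1)" unfolding power_inverse[symmetric] by (simp only: inverse_divide)
  finally have ex: "exp (- x) \<le> (?D / x) ^ (d + 1)" by (simp only: exp_minus)
  have "real ((2 * n + 1) ^ d) \<le> (3 * real n) ^ d"
    using n0 unfolding of_nat_power by (intro power_mono) auto
  then have "2 * real ((2 * n + 1) ^ d) * exp (- x) / (2 * x) \<le> 2 * (3 * real n) ^ d * (?D / x) ^ (d + 1) / (2 * x)"
    using ex x by (intro divide_right_mono mult_mono) auto
  also have "\<dots> = 3 ^ d * 2 ^ (d + 2) * (?D ^ (d + 1) * q ^ (d + 2)) / (real n)\<^sup>2"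
  proof -
    have "2 * (3 * real n) ^ d * (a / x) ^ (d + 1) / (2 * x)
        = 3 ^ d * 2 ^ (d + 2) * (a ^ (d + 1) * q ^ (d + 2)) / (real n)\<^sup>2" for a :: real
      unfolding x_def using q n0
      by (simp add: power_mult_distrib power_divide power2_eq_square field_simps)
    then show ?thesis .
  qed
  also have "\<dots> \<le> 12 ^ (d + 1) * (?D ^ (d + 1) * q ^ (d + 2)) / (real n)\<^sup>2"
  proof (intro divide_right_mono mult_right_mono)
    have "(3::real) ^ d * 2 ^ (d + 2) = 4 * 6 ^ d"
      by (simp add: power_mult_distrib[symmetric])
    also have "\<dots> \<le> 12 * 12 ^ d" by (intro mult_mono power_mono) auto
    finally show "(3::real) ^ d * 2 ^ (d + 2) \<le> 12 ^ (d + 1)" by simp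
  qed (use q in auto)
  also have "\<dots> = m / (real n)\<^sup>2" unfolding m by (simp only: power_mult_distrib mult.assoc)
  also have "\<dots> \<le> m / m\<^sup>2" using m0 mn by (intro divide_left_mono power_mono) auto
  also have "\<dots> = 1 / m" using m0 by (simp add: power2_eq_square)
  also have "\<dots> < 1 / 2 ^ j" using mj m0 by (intro divide_strict_left_mono) auto
  finally show ?thesis unfolding xe by simp
qed

text \<open>Outside the bad event risk and empirical risk differ by at most \<open>2 * e\<close>
  throughout \<open>C\<close>, so a minimizer of the latter is within
  \<open>4 * e = 1 / 2 ^ k\<close> of the infimum.\<close>

lemma erm_properly_PAC_learns:
  assumes VC: "VCdim C \<le> enat d" and ne: "C \<noteq> {}" and erm: "empirical_risk_minimizer A C"
  shows "properly_PAC_learns A C (sample_bound d)"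
  unfolding properly_PAC_learns_def
proof (intro conjI allI impI)
  show "range A \<subseteq> C" using erm unfolding empirical_risk_minimizer_def by blast
  fix i j n and D :: "(nat \<times> bool) pmf"
  define k where "k = cantor_pair i j"
  assume n: "sample_bound d (cantor_pair i j) \<le> n"
  \<comment> \<open>Up to the order of the arguments this is the library pairing, which dominates
    both components.\<close>
  have "cantor_pair i j = prod_encode (j, i)"
    by (simp add: cantor_pair_def prod_encode_def triangle_def add.commute)
  then have k: "i \<le> k" "j \<le> k" unfolding k_def by (simp_all add: le_prod_encode_1 le_prod_encode_2)
  define e where "e = (1 / 2 ^ (k + 2) :: real)"
  have e: "0 < e" "4 * e \<le> 1 / 2 ^ i"
    using k(1) unfolding e_def by (simp_all add: frac_le)
  have n0: "0 < n" using n unfolding sample_bound_def by (auto intro: Nat.gr0I)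
  let ?P = "replicate_pmf n D"
  let ?bad = "{S. \<exists>u\<in>loss ` C. \<bar>measure_pmf.expectation D u - (\<Sum>z\<leftarrow>S. u z) / real n\<bar> > 2 * e}"
  let ?good = "{S. risk D (A S) \<le> (INF h\<in>C. risk D h) + 1 / 2 ^ i}"
  have "measure_pmf.prob ?P ?bad \<le> 2 * real ((2 * n + 1) ^ d) * exp (- (real n * e\<^sup>2 / 2)) / (real n * e\<^sup>2)"
  proof (rule uniform_convergence)
    fix X :: "(nat \<times> bool) set" assume X: "finite X" "card X \<le> 2 * n"
    have "card (trace_on (loss ` C) X) \<le> (card X + 1) ^ d" by (rule trace_on_loss(2)[OF X(1) VC])
    also have "\<dots> \<le> (2 * n + 1) ^ d" using X(2) by (intro power_mono) auto
    finally show "card (trace_on (loss ` C) X) \<le> (2 * n + 1) ^ d" .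
  qed (use e(1) n0 trace_on_loss(1) in \<open>auto simp: loss_def\<close>)
  also have "\<dots> < 1 / 2 ^ j"
    unfolding e_def by (rule sample_bound_suffices) (use n k in \<open>simp_all add: k_def\<close>)
  finally have bad: "measure_pmf.prob ?P ?bad < 1 / 2 ^ j" .
  have "S \<in> ?good" if S: "S \<in> set_pmf ?P" "S \<notin> ?bad" for S
  proof -
    have "length S = n" using S(1) by (simp add: set_replicate_pmf)
    then have dev: "\<bar>risk D h - empirical_risk S h\<bar> \<le> 2 * e" if "h \<in> C" for h
      using S(2) that by (force simp: risk_eq_expectation empirical_risk_eq_sum)
    have AS: "A S \<in> C" "empirical_risk S (A S) = Min (empirical_risk S ` C)"
      using erm unfolding empirical_risk_minimizer_def by auto
    have "risk D (A S) - 4 * e \<le> risk D h" if "h \<in> C" for h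
    proof -
      have "empirical_risk S (A S) \<le> empirical_risk S h"
        unfolding AS(2) using that finite_empirical_risk by (intro Min_le) auto
      then show ?thesis using dev[OF AS(1)] dev[OF that] by linarith
    qed
    then have "risk D (A S) - 4 * e \<le> (INF h\<in>C. risk D h)" using ne by (intro cINF_greatest) auto
    then show ?thesis using e(2) by simp
  qed
  \<comment> \<open>The comparison is made on the support, where samples have length
    \<open>n\<close>; its complement is null.\<close>
  then have "measure_pmf.prob ?P (- ?bad \<inter> set_pmf ?P) \<le> measure_pmf.prob ?P ?good"
    by (intro measure_pmf.finite_measure_mono) auto
  moreover have "measure_pmf.prob ?P (- ?bad \<inter> set_pmf ?P) = 1 - measure_pmf.prob ?P ?bad"
    using measure_pmf.prob_compl[of ?bad ?P] by (simp add: measure_Int_set_pmf Compl_eq_Diff_UNIV)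
  ultimately show "1 - 1 / 2 ^ j < measure_pmf.prob ?P ?good" using bad by linarith
qed

section \<open>Reductions\<close>

lemma computable_problem_PPAC: "computable_problem PPAC"
proof -
  let ?L = "\<lambda>r. learner_of (tree_of (the (rep_closed r)))"
  define P where "P = {r. rep_closed (evens r) \<noteq> None \<and> rep_closed (evens r) \<noteq> Some {}}"
  \<comment> \<open>The even half of the output names the learner, the odd half is the sample size
    function; \<open>r 1\<close> is entry \<open>0\<close> of the odd half of the input, that is,
    the bound \<open>d\<close>.\<close>
  define F where "F r n = (if even n then ?L (evens r) (n div 2) else sample_bound (r 1) (n div 2))" for r n
  have "computable_on P evens" unfolding evens_def by (intro computable_intros)
  then have "computable_on P (\<lambda>r. ?L (evens r))"
    by (rule computable_on_comp_oracle[OF computable_learner_of_tree]) (simp add: P_def closed_names_def)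
  then have "computable_on P (\<lambda>r n. ?L (evens r) (n div 2))"
    by (rule computable_comp) (intro computable_intros)
  then have "computable_on P F"
    unfolding F_def sample_bound_def by (intro computable_intros)
  moreover have "realizes (restrict_to P F) PPAC"
    unfolding realizes_def
  proof (intro allI impI, elim conjE)
    fix r x V
    assume "in_rep PPAC r = Some x" "solutions PPAC x = Some V"
    moreover obtain C d where "x = (C, d)" by fastforce
    ultimately have C: "rep_closed (evens r) = Some C" "d = r 1" "closed C" "VCdim C \<le> enat d" "C \<noteq> {}"
      and V: "V = {(A, m). properly_PAC_learns A C m}"
      by (auto simp: PPAC_def rep_prod_def rep_nat_def odds_def bind_eq_Some_conv split: if_splits)
    obtain A where A: "rep_learner (?L (evens r)) = Some A" "empirical_risk_minimizer A C"
      using learner_of_erm[OF C(3,5)] C(1) by auto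
    have "evens (F r) = ?L (evens r)" "odds (F r) = sample_bound d"
      unfolding F_def C(2) by (simp_all add: evens_def odds_def fun_eq_iff)
    then have "out_rep PPAC (F r) = Some (A, sample_bound d)"
      using A by (simp add: PPAC_def rep_prod_def rep_baire_def)
    moreover have "(A, sample_bound d) \<in> V"
      using erm_properly_PAC_learns[OF C(4,5) A(2)] V by simp
    moreover have "restrict_to P F r = Some (F r)"
      using C by (simp add: restrict_to_def P_def)
    ultimately show "\<exists>q y. restrict_to P F r = Some q \<and> out_rep PPAC q = Some y \<and> y \<in> V"
      by blast
  qed
  ultimately show ?thesis
    unfolding computable_problem_def using computable_restrict_to by blast
qed

text \<open>An instance of \<open>PPAC_less d\<close> satisfies the bound \<open>d\<close>, so it
  suffices to supply the constant \<open>d\<close> as second input; the solutions are the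
  same.\<close>

lemma PPAC_less_le_PPAC: "PPAC_less d \<le>\<^sub>s\<^sub>W PPAC"
proof -
  define K where "K r n = (if even n then r (n div 2) else d)" for r :: baire and n
  have "computable_on UNIV K" unfolding K_def by (intro computable_intros)
  then have "computable (restrict_to UNIV K)" by (rule computable_restrict_to)
  moreover have "realizes (Some \<circ>\<^sub>m (G \<circ>\<^sub>m restrict_to UNIV K)) (PPAC_less d)" if G: "realizes G PPAC" for G
    unfolding realizes_def
  proof (intro allI impI, elim conjE)
    fix r C V
    assume r: "in_rep (PPAC_less d) r = Some C" and C: "solutions (PPAC_less d) C = Some V"
    have "evens (K r) = r" "odds (K r) 0 = d" by (simp_all add: evens_def odds_def K_def fun_eq_iff)
    then have "in_rep PPAC (K r) = Some (C, d)" "solutions PPAC (C, d) = Some V"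
      using r C by (auto simp: PPAC_less_def PPAC_def rep_prod_def rep_nat_def split: if_splits)
    then obtain q y where "G (K r) = Some q" "out_rep PPAC q = Some y" "y \<in> V"
      using G unfolding realizes_def by blast
    then show "\<exists>q y. (Some \<circ>\<^sub>m (G \<circ>\<^sub>m restrict_to UNIV K)) r = Some q \<and>
        out_rep (PPAC_less d) q = Some y \<and> y \<in> V"
      by (cases y) (simp add: restrict_to_def PPAC_def PPAC_less_def)
  qed
  ultimately show ?thesis unfolding sW_le_def using computable_Some by blast
qed

section \<open>Coding a point of Baire space into a singleton class\<close>

definition graph_point :: "baire \<Rightarrow> cantor" where
  "graph_point p i \<longleftrightarrow> p (pfst i) = psnd i"

text \<open>Even positions list the cylinders that contain the point and odd positions those that
  miss it. The entry \<open>0\<close> conveys no information.\<close>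

definition graph_name :: "baire \<Rightarrow> baire" where
  "graph_name p k = (if even k \<longleftrightarrow> (\<forall>i<length (word (k div 2)). word_bit (k div 2) i \<longleftrightarrow> p (pfst i) = psnd i)
     then k div 2 + 1 else 0)"

lemma computable_graph_name: "computable_on UNIV graph_name"
  unfolding graph_name_def by (intro computable_intros)

lemma rep_closed_graph_name: "rep_closed (graph_name p) = Some {graph_point p}"
proof -
  let ?x = "graph_point p"
  have "(\<forall>i<length (word a). word_bit a i \<longleftrightarrow> p (pfst i) = psnd i) \<longleftrightarrow> ?x \<in> cylinder (word a)" for a
    by (auto simp: word_bit cylinder_def graph_point_def)
  then have name: "graph_name p k = (if even k \<longleftrightarrow> ?x \<in> cylinder (word (k div 2)) then k div 2 + 1 else 0)" for k
    unfolding graph_name_def by simp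
  have e: "{n. n + 1 \<in> range (evens (graph_name p))} = {n. ?x \<in> cylinder (word n)}"
    unfolding evens_def name by (auto simp: image_iff split: if_splits)
  have o: "{n. n + 1 \<in> range (odds (graph_name p))} = {n. ?x \<notin> cylinder (word n)}"
    unfolding odds_def name by (auto simp: image_iff split: if_splits)
  have "\<exists>n. ?x \<notin> cylinder (word n) \<and> y \<in> cylinder (word n)" if "y \<noteq> ?x" for y
  proof -
    obtain i where "y i \<noteq> ?x i" using \<open>y \<noteq> ?x\<close> by auto
    then have "?x \<notin> cylinder (map y [0..<Suc i])" "y \<in> cylinder (map y [0..<Suc i])"
      by (auto simp: cylinder_def simp del: upt_Suc)
    then show ?thesis by (metis word_word_index)
  qed
  then have A: "UNIV - (\<Union>n\<in>{n. ?x \<notin> cylinder (word n)}. cylinder (word n)) = {?x}" by blast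
  show ?thesis unfolding rep_closed_def Let_def o e A by auto
qed

text \<open>A singleton leaves one trace on any set, so shattering \<open>A\<close> forces
  \<open>2 ^ card A = 1\<close>.\<close>

lemma VCdim_singleton: "VCdim {x} = 0"
proof -
  have "card A = 0" if "shatters {x} A" for A
    using that unfolding shatters_def by (cases "card A") auto
  then have "enat (card A) \<le> 0" if "shatters {x} A" for A
    using that by (simp add: zero_enat_def)
  then have "VCdim {x} \<le> 0" unfolding VCdim_def by (intro SUP_least) auto
  then show ?thesis by simp
qed

text \<open>The code of the empty sample is \<open>0\<close>. Already there a proper learner of a
  singleton must output its only member, whose graph is searched for the value at
  \<open>n\<close>.\<close>

definition graph_read :: "baire \<Rightarrow> baire" where
  "graph_read q n = (LEAST k. q (prod_encode (prod_encode (n, k), 0)) = 1)"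

definition graph_readable :: "baire set" where
  "graph_readable = {q. \<forall>n. \<exists>k. q (prod_encode (prod_encode (n, k), 0)) = 1}"

lemma computable_graph_read: "computable_on graph_readable graph_read"
  unfolding graph_read_def
  by (intro computable_Least computable_intros) (simp add: graph_readable_def)

lemma graph_read_learner:
  assumes "rep_learner q = Some A" "A [] = graph_point p"
  shows "q \<in> graph_readable \<and> graph_read q = p"
proof -
  have "A = (\<lambda>S x. q (query_code (x, S)) = 1)"
    using assms(1) by (auto simp: rep_learner_def split: if_splits)
  then have "q (prod_encode (x, 0)) = 1 \<longleftrightarrow> graph_point p x" for x
    using assms(2) by (auto simp: query_code_def fun_eq_iff)
  then have "q (prod_encode (prod_encode (n, k), 0)) = 1 \<longleftrightarrow> p n = k" for n k
    by (simp add: graph_point_def)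
  then show ?thesis
    by (auto simp: graph_readable_def graph_read_def fun_eq_iff intro: Least_equality)
qed

text \<open>An arbitrary realizer may return any name of any solution, so \<open>H\<close> has to
  recover \<open>p\<close> from all of them.\<close>

lemma id_leI:
  assumes H: "computable_on P H" and K: "computable_on UNIV K"
    and sol: "\<And>p. \<exists>x V. in_rep f (K p) = Some x \<and> solutions f x = Some V \<and>
      (\<forall>q y. out_rep f q = Some y \<and> y \<in> V \<longrightarrow> q \<in> P \<and> H q = p)"
  shows "id_problem \<le>\<^sub>s\<^sub>W f"
proof -
  have "realizes (restrict_to P H \<circ>\<^sub>m (G \<circ>\<^sub>m restrict_to UNIV K)) id_problem" if G: "realizes G f" for G
  proof -
    have "(restrict_to P H \<circ>\<^sub>m (G \<circ>\<^sub>m restrict_to UNIV K)) p = Some p" for p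
    proof -
      obtain x V where x: "in_rep f (K p) = Some x" "solutions f x = Some V"
        "\<And>q y. out_rep f q = Some y \<Longrightarrow> y \<in> V \<Longrightarrow> q \<in> P \<and> H q = p"
        using sol[of p] by blast
      then obtain q y where "G (K p) = Some q" "out_rep f q = Some y" "y \<in> V"
        using G unfolding realizes_def by blast
      with x(3)[of q y] show ?thesis by (simp add: restrict_to_def)
    qed
    then show ?thesis by (simp add: realizes_def id_problem_def rep_baire_def)
  qed
  then show ?thesis
    unfolding sW_le_def using computable_restrict_to[OF H] computable_restrict_to[OF K] by blast
qed

lemma id_le_ERM: "id_problem \<le>\<^sub>s\<^sub>W ERM"
proof (rule id_leI[OF computable_graph_read computable_graph_name])
  fix p
  have "q \<in> graph_readable \<and> graph_read q = p"
    if "rep_learner q = Some A" "empirical_risk_minimizer A {graph_point p}" for q A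
    using graph_read_learner[OF that(1)] that(2) unfolding empirical_risk_minimizer_def by blast
  then show "\<exists>x V. in_rep ERM (graph_name p) = Some x \<and> solutions ERM x = Some V \<and>
      (\<forall>q y. out_rep ERM q = Some y \<and> y \<in> V \<longrightarrow> q \<in> graph_readable \<and> graph_read q = p)"
    \<comment> \<open>The singleton is closed because it has a name.\<close>
    using rep_closedD(3)[OF rep_closed_graph_name[of p]] by (auto simp: ERM_def rep_closed_graph_name)
qed

text \<open>A singleton has VC dimension \<open>0\<close>, so \<open>0 < d\<close> makes it an
  instance. The learner is named by the even half of the output.\<close>

lemma id_le_PPAC_less:
  assumes "0 < d"
  shows "id_problem \<le>\<^sub>s\<^sub>W PPAC_less d"
proof (rule id_leI[OF _ computable_graph_name])
  have "computable_on (evens -` graph_readable) evens"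
    unfolding evens_def by (intro computable_intros)
  then show "computable_on (evens -` graph_readable) (\<lambda>q. graph_read (evens q))"
    by (rule computable_on_comp_oracle[OF computable_graph_read]) simp
  fix p
  have "evens q \<in> graph_readable \<and> graph_read (evens q) = p"
    if "rep_prod rep_learner rep_baire q = Some (A, m)" "properly_PAC_learns A {graph_point p} m" for q A m
  proof (rule graph_read_learner)
    show "rep_learner (evens q) = Some A"
      using that(1) by (auto simp: rep_prod_def bind_eq_Some_conv)
    show "A [] = graph_point p"
      using that(2) unfolding properly_PAC_learns_def by blast
  qed
  then show "\<exists>x V. in_rep (PPAC_less d) (graph_name p) = Some x \<and> solutions (PPAC_less d) x = Some V \<and>
      (\<forall>q y. out_rep (PPAC_less d) q = Some y \<and> y \<in> V \<longrightarrow>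
        q \<in> evens -` graph_readable \<and> graph_read (evens q) = p)"
    using assms rep_closedD(3)[OF rep_closed_graph_name[of p]]
    by (auto simp: PPAC_less_def rep_closed_graph_name VCdim_singleton enat_0_iff zero_enat_def)
qed

theorem theorem43:
  fixes d :: nat
  assumes "1 < d"
  shows "ERM \<equiv>\<^sub>s\<^sub>W PPAC \<and> PPAC \<equiv>\<^sub>s\<^sub>W PPAC_less d \<and> PPAC_less d \<equiv>\<^sub>s\<^sub>W id_problem \<and>
    computable_problem ERM \<and> computable_problem PPAC \<and>
    computable_problem (PPAC_less d) \<and> computable_problem id_problem"
proof -
  have ERM: "ERM \<le>\<^sub>s\<^sub>W id_problem" and PPAC: "PPAC \<le>\<^sub>s\<^sub>W id_problem"
    using computable_problem_ERM computable_problem_PPAC computable_problem_iff_le_id by blast+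
  have id_less: "id_problem \<le>\<^sub>s\<^sub>W PPAC_less d" using id_le_PPAC_less assms by simp
  have less: "PPAC_less d \<le>\<^sub>s\<^sub>W id_problem" by (rule sW_le_trans[OF PPAC_less_le_PPAC PPAC])
  have id_PPAC: "id_problem \<le>\<^sub>s\<^sub>W PPAC" by (rule sW_le_trans[OF id_less PPAC_less_le_PPAC])
  \<comment> \<open>Reflexivity expresses that \<open>id_problem\<close> is itself
    computable.\<close>
  have "id_problem \<le>\<^sub>s\<^sub>W id_problem" by (rule sW_le_trans[OF id_PPAC PPAC])
  then show ?thesis
    unfolding sW_eq_def computable_problem_iff_le_id
    by (intro conjI ERM PPAC less id_less sW_le_trans[OF ERM id_PPAC] sW_le_trans[OF PPAC id_le_ERM]
        sW_le_trans[OF PPAC id_less] PPAC_less_le_PPAC)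
qed

end
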